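(* Let $s\leq d$ be positive integers and suppose $K\subset\mathbb R^d$ is an asymptotically flat $s$-regular set or a quasi-nice $s$-regular set. Let $X_N=\{x_1,\dots,x_N\}$ be a set of $N$ independently and randomly distributed points over $K$ with respect to the measure $\mathrm d\mu:=\mathbf 1_K\cdot\mathrm d\mathcal H_s/\mathcal H_s(K)$. Then for any $p\geq1$, $$\lim_{N\to\infty}\mathbb E[\rho(X_N,K)^p]\cdot\left[\frac{N}{\log N}\right]^{p/s}=\left(\frac{\mathcal H_s(K)}{\upsilon_s}\right)^{p/s}.$$
   Context: $\mathcal H_s$ is $s$-dimensional Hausdorff measure on $\mathbb R^d$ (Euclidean metric), normalized by $\mathcal H_s([0,1]^s)=1$; $\upsilon_s=\pi^{s/2}/\Gamma(1+s/2)$ is the volume of the unit ball in $\mathbb R^s$; $B_d(x,r)$ is the closed Euclidean ball in $\mathbb R^d$. The covering radius is $\rho(X_N,K):=\sup_{y\in K}\min_j|y-x_j|$. Let $K$ be a compact $s$-dimensional set in $\mathbb R^d$. $K$ is an asymptotically flat $s$-regular set if $r^{-s}\mathcal H_s(B_d(x,r)\cap K)\to\upsilon_s$ as $r\to0^+$, uniformly in $x\in K$. $K$ is a quasi-nice $s$-regular set if: (i) $K$ is countably $s$-rectifiable; i.e., $K$ is of the form $\bigcup_{j=1}^\infty f_j(E_j)\cup G$, where $\mathcal H_s(G)=0$ and each $f_j$ is a Lipschitz function from a bounded subset $E_j$ of $\mathbb R^s$ to $\mathbb R^d$; (ii) there exist positive numbers $c,C,r_0$ such that for any $x\in K$ and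 any $0<r<r_0$, $cr^s\leq\mathcal H_s(B_d(x,r)\cap K)\leq Cr^s$; (iii) there is a finite set $T\subset K$ such that for any $0<r<r_0$ and $y\in K\setminus\bigcup_{x_t\in T}B_d(x_t,r)$ it holds that $\mathcal H_s(B_d(y,r)\cap K)\geq\upsilon_sr^s$. *)

theory Defs
  imports "HOL-Probability.Probability"
begin

text \<open>
  Throughout, the integer dimension s is \<open>CARD('s)\<close> for a finite index type \<open>'s\<close>,
  so that the s-dimensional Euclidean space is the type \<open>real ^ 's\<close>.
\<close>

text \<open>
  The convention \<open>0 ^ 0 = 1\<close> is needed for nonempty sets, whereas \<open>0 powr 0 = 0\<close>.
\<close>
definition diam_powr :: "real \<Rightarrow> 'a::metric_space set \<Rightarrow> ennreal" where
  "diam_powr t U =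
     (if U = {} then 0 else if t = 0 then 1 else ennreal (diameter U powr t))"

text \<open>
  The covering sets are required to be bounded because \<open>diameter\<close> is
  meaningful only for bounded sets.
\<close>
definition hausdorff_delta :: "real \<Rightarrow> real \<Rightarrow> 'a::metric_space set \<Rightarrow> ennreal" where
  "hausdorff_delta t \<delta> A =
     (INF U \<in> {U :: nat \<Rightarrow> 'a set. A \<subseteq> (\<Union>i. U i) \<and>
                 (\<forall>i. bounded (U i) \<and> diameter (U i) \<le> \<delta>)}.
        (\<Sum>i. diam_powr t (U i)))"

definition unnormalized_hausdorff :: "real \<Rightarrow> 'a::metric_space set \<Rightarrow> ennreal" where
  "unnormalized_hausdorff t A = (SUP \<delta> \<in> {0<..}. hausdorff_delta t \<delta> A)"

text \<open>The normalization does not affect which sets are null, hence not the dimension.\<close>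
definition hausdorff_dim :: "'a::metric_space set \<Rightarrow> ennreal" where
  "hausdorff_dim A = (INF t \<in> {t. 0 \<le> t \<and> unnormalized_hausdorff t A = 0}. ennreal t)"

text \<open>
  The outer measure \<open>\<H>\<^sub>s\<close>, scaled so that the unit cube of \<open>real ^ 's\<close> has value \<open>1\<close>.
  It is isometry invariant, so any isometric copy of that cube in another space
  has value \<open>1\<close> as well.
\<close>
definition hausdorff :: "'s::finite itself \<Rightarrow> 'a::metric_space set \<Rightarrow> ennreal" where
  "hausdorff _ A =
     unnormalized_hausdorff (real CARD('s)) A /
     unnormalized_hausdorff (real CARD('s)) (cbox 0 1 :: (real ^ 's) set)"

text \<open>
  Hausdorff measure on the Borel sets. As \<open>hausdorff\<close> is a metric outer measure,
  it is countably additive there by Caratheodory's criterion.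
\<close>
definition hausdorff_measure :: "'s::finite itself \<Rightarrow> 'a::metric_space measure" where
  "hausdorff_measure S = measure_of UNIV (sets borel) (hausdorff S)"

definition countably_rectifiable :: "'s::finite itself \<Rightarrow> (real ^ 'd) set \<Rightarrow> bool" where
  "countably_rectifiable S K \<longleftrightarrow>
     (\<exists>(E :: nat \<Rightarrow> (real ^ 's) set) (f :: nat \<Rightarrow> real ^ 's \<Rightarrow> real ^ 'd) G.
        (\<forall>j. bounded (E j) \<and> (\<exists>L. L-lipschitz_on (E j) (f j))) \<and>
        hausdorff S G = 0 \<and>
        K = (\<Union>j. f j ` E j) \<union> G)"

text \<open>
  Since the limit \<open>unit_ball_vol s\<close> is positive and \<open>enn2real \<infinity> = 0\<close>,
  passing to real values cannot hide balls of infinite measure.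
\<close>
definition asymptotically_flat_regular :: "'s::finite itself \<Rightarrow> (real ^ 'd) set \<Rightarrow> bool" where
  "asymptotically_flat_regular S K \<longleftrightarrow>
     compact K \<and> hausdorff_dim K = of_nat CARD('s) \<and>
     uniform_limit K
       (\<lambda>r x. enn2real (hausdorff S (cball x r \<inter> K)) / r ^ CARD('s))
       (\<lambda>x. unit_ball_vol (real CARD('s)))
       (at_right 0)"

definition quasi_nice_regular :: "'s::finite itself \<Rightarrow> (real ^ 'd) set \<Rightarrow> bool" where
  "quasi_nice_regular S K \<longleftrightarrow>
     compact K \<and> hausdorff_dim K = of_nat CARD('s) \<and>
     countably_rectifiable S K \<and>
     (\<exists>c C r0. 0 < c \<and> 0 < C \<and> 0 < r0 \<and>
        (\<forall>x\<in>K. \<forall>r. 0 < r \<and> r < r0 \<longrightarrow>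
           ennreal (c * r ^ CARD('s)) \<le> hausdorff S (cball x r \<inter> K) \<and>
           hausdorff S (cball x r \<inter> K) \<le> ennreal (C * r ^ CARD('s))) \<and>
        (\<exists>T. finite T \<and> T \<subseteq> K \<and>
           (\<forall>r. 0 < r \<and> r < r0 \<longrightarrow>
              (\<forall>y \<in> K - (\<Union>t\<in>T. cball t r).
                 ennreal (unit_ball_vol (real CARD('s)) * r ^ CARD('s))
                   \<le> hausdorff S (cball y r \<inter> K)))))"

definition covering_radius :: "(real ^ 'd) set \<Rightarrow> (real ^ 'd) set \<Rightarrow> real" where
  "covering_radius X K = (SUP y\<in>K. MIN x\<in>X. norm (y - x))"

end

theory Submission
  imports Defs "HOL-Real_Asymp.Real_Asymp"
begin

text \<open>
  Write \<open>v = \<upsilon>\<^sub>s / \<H>\<^sub>s(K)\<close>. A ball of radius \<open>r\<close> around a typical point of \<open>K\<close> has probability about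
  \<open>v * r^s\<close>. At the radius \<open>r = a * (ln N / N)^(1/s)\<close> it contains none of the \<open>N\<close> points with
  probability about \<open>N^(- v * a^s)\<close>, while \<open>K\<close> accommodates about \<open>N / ln N\<close> disjoint balls of this
  radius. So empty balls should exist if \<open>v * a^s < 1\<close> and should not if \<open>v * a^s > 1\<close>, and
  the rescaled covering radius concentrates at the critical value \<open>a = v^(-1/s)\<close>.

  Upper bound. A covering radius above \<open>h + r\<close> forces an empty ball of radius \<open>r\<close> around some point of
  an \<open>h\<close>-net, with \<open>h\<close> a small multiple of \<open>r\<close>, and a union bound applies (\<open>prob_\<rho>_gt_le\<close>). In the
  quasi-nice case the net points within \<open>r\<close> of the finite set \<open>T\<close> have only a crude mass bound, but
  their number is bounded. The same union bound at a large multiple of the scale has probability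
  smaller than any prescribed power of \<open>N\<close>, which controls the moments.

  Lower bound. Among many disjoint balls, the number of those containing no point of the sample has
  pairwise negatively correlated summands, so by the second moment method some ball is empty with
  probability tending to \<open>1\<close> (\<open>prob_some_missed_ge\<close>). This needs many disjoint balls with
  probability at most \<open>(1 + \<epsilon>) * v * r^s\<close>. They exist because the upper density of a set of finite
  Hausdorff measure is almost everywhere at most \<open>1\<close>, which is a Vitali covering argument
  (\<open>hausdorff_le_of_upper_density\<close>, \<open>exists_nonnull_low_density\<close>). The constant \<open>\<upsilon>\<^sub>s\<close> enters there
  through the comparison of covers of the unit cube with its volume, which is the isodiametric
  inequality; it is proved by Steiner symmetrization (\<open>isodiametric_inequality\<close>).
\<close>

section \<open>The isodiametric inequality\<close>

text \<open>
  Both \<open>Sup A - Inf B\<close> and \<open>Sup B - Inf A\<close> are at most \<open>w\<close>, and their sum is the total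
  length of the convex hulls of \<open>A\<close> and \<open>B\<close>. This is the one-dimensional fact behind the
  monotonicity of diameters under Steiner symmetrization.
\<close>
lemma emeasure_add_le_of_dist_le:
  fixes A B :: "real set"
  assumes "A \<noteq> {}" "B \<noteq> {}" and w: "\<And>a b. a \<in> A \<Longrightarrow> b \<in> B \<Longrightarrow> \<bar>a - b\<bar> \<le> w"
  shows "emeasure lborel A + emeasure lborel B \<le> ennreal (2 * w)"
proof -
  obtain a0 b0 where a0: "a0 \<in> A" and b0: "b0 \<in> B" using assms by blast
  have bA: "bdd_above A" "bdd_below A"
    using w[OF _ b0] by (auto intro!: bdd_aboveI[of _ "b0 + w"] bdd_belowI[of _ "b0 - w"] simp: abs_le_iff algebra_simps)
  have bB: "bdd_above B" "bdd_below B"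
    using w[OF a0] by (auto intro!: bdd_aboveI[of _ "a0 + w"] bdd_belowI[of _ "a0 - w"] simp: abs_le_iff algebra_simps)
  have le: "Inf A \<le> Sup A" "Inf B \<le> Sup B"
    using a0 b0 bA bB by (meson cInf_lower cSup_upper order_trans)+
  have "emeasure lborel A \<le> emeasure lborel {Inf A .. Sup A}"
    using bA by (intro emeasure_mono) (auto intro: cInf_lower cSup_upper)
  then have 1: "emeasure lborel A \<le> ennreal (Sup A - Inf A)" using le by simp
  have "emeasure lborel B \<le> emeasure lborel {Inf B .. Sup B}"
    using bB by (intro emeasure_mono) (auto intro: cInf_lower cSup_upper)
  then have 2: "emeasure lborel B \<le> ennreal (Sup B - Inf B)" using le by simp
  have "Sup A - w \<le> b" if "b \<in> B" for b
    using cSup_least[OF \<open>A \<noteq> {}\<close>, of "b + w"] w[OF _ that] by (simp add: abs_le_iff algebra_simps)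
  then have 3: "Sup A - w \<le> Inf B" using \<open>B \<noteq> {}\<close> by (intro cInf_greatest)
  have "Sup B - w \<le> a" if "a \<in> A" for a
    using cSup_least[OF \<open>B \<noteq> {}\<close>, of "a + w"] w[OF that] by (simp add: abs_le_iff algebra_simps)
  then have 4: "Sup B - w \<le> Inf A" using \<open>A \<noteq> {}\<close> by (intro cInf_greatest)
  have "emeasure lborel A + emeasure lborel B \<le> ennreal (Sup A - Inf A) + ennreal (Sup B - Inf B)"
    using 1 2 by (rule add_mono)
  also have "\<dots> = ennreal (Sup A - Inf A + (Sup B - Inf B))" using le by (subst ennreal_plus) auto
  also have "\<dots> \<le> ennreal (2 * w)" using 3 4 by (intro ennreal_leI) linarith
  finally show ?thesis .
qed

abbreviation lebPi :: "'i set \<Rightarrow> ('i \<Rightarrow> real) measure" where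
  "lebPi I \<equiv> PiM I (\<lambda>_. lborel)"

text \<open>
  Steiner symmetrization along the \<open>i\<close>-th axis: every fibre in that direction is replaced by the
  open interval of the same length centred at \<open>0\<close>. The strict inequality discards the points over
  null fibres, so that points of the new set always have nonempty fibres of the old one. The
  coordinates form a function space over a finite index set rather than a Euclidean space because
  there Fubini's theorem for a single coordinate is available.
\<close>
definition steiner :: "'i set \<Rightarrow> 'i \<Rightarrow> ('i \<Rightarrow> real) set \<Rightarrow> ('i \<Rightarrow> real) set" where
  "steiner I i A = {x \<in> space (lebPi I). ennreal (2 * \<bar>x i\<bar>) < emeasure lborel {t. x(i := t) \<in> A}}"

lemma fiber_measurable:
  assumes "A \<in> sets (lebPi I)" "i \<in> I" "x \<in> space (lebPi (I - {i})) \<or> x \<in> space (lebPi I)"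
  shows "{t. x(i := t) \<in> A} \<in> sets lborel"
proof -
  have "(\<lambda>t. x(i := t)) \<in> lborel \<rightarrow>\<^sub>M lebPi I"
  proof (cases "x \<in> space (lebPi I)")
    case True
    show ?thesis
      by (rule measurable_fun_upd[where J = I]) (use assms True in auto)
  next
    case False
    show ?thesis
      by (rule measurable_fun_upd[where J = "I - {i}"]) (use assms False in auto)
  qed
  from measurable_sets[OF this assms(1)] show ?thesis by (simp add: vimage_def)
qed

lemma sets_steiner:
  assumes A: "A \<in> sets (lebPi I)" and i: "i \<in> I"
  shows "steiner I i A \<in> sets (lebPi I)"
proof -
  have m: "(\<lambda>(x, t). x(i := t)) \<in> lebPi I \<Otimes>\<^sub>M lborel \<rightarrow>\<^sub>M lebPi I"
    unfolding case_prod_beta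
    by (rule measurable_fun_upd[where J = I]) (use i in auto)
  have "(\<lambda>(x, t). indicator A (x(i := t)) :: ennreal) \<in> borel_measurable (lebPi I \<Otimes>\<^sub>M lborel)"
    using measurable_compose[OF m borel_measurable_indicator[OF A]] unfolding case_prod_beta .
  then have "(\<lambda>x. \<integral>\<^sup>+t. indicator A (x(i := t)) \<partial>lborel) \<in> borel_measurable (lebPi I)"
    by (rule lborel.borel_measurable_nn_integral[where f = "\<lambda>x t. indicator A (x(i := t))"])
  moreover have "(\<integral>\<^sup>+t. indicator A (x(i := t)) \<partial>lborel) = emeasure lborel {t. x(i := t) \<in> A}"
    if "x \<in> space (lebPi I)" for x
  proof -
    have "(\<integral>\<^sup>+t. indicator A (x(i := t)) \<partial>lborel) = (\<integral>\<^sup>+t. indicator {t. x(i := t) \<in> A} t \<partial>lborel)"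
      by (simp add: indicator_def)
    then show ?thesis using fiber_measurable[OF A i disjI2[OF that]] by simp
  qed
  ultimately have [measurable]: "(\<lambda>x. emeasure lborel {t. x(i := t) \<in> A}) \<in> borel_measurable (lebPi I)"
    by (simp cong: measurable_cong)
  have [measurable]: "(\<lambda>x. x i) \<in> borel_measurable (lebPi I)"
    using measurable_component_singleton[OF i, of "\<lambda>_. lborel"] by simp
  show ?thesis unfolding steiner_def by measurable
qed

definition sq_dist :: "'i set \<Rightarrow> ('i \<Rightarrow> real) \<Rightarrow> ('i \<Rightarrow> real) \<Rightarrow> real" where
  "sq_dist I x y = (\<Sum>i\<in>I. (x i - y i)\<^sup>2)"

lemma sq_dist_fun_upd:
  assumes "finite I" "i \<in> I"
  shows "sq_dist I (x(i := a)) (y(i := b)) = (a - b)\<^sup>2 + sq_dist (I - {i}) x y"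
  unfolding sq_dist_def by (subst sum.remove[OF assms]) (auto intro!: sum.cong)

lemma fiber_pair_le:
  assumes I: "finite I" "i \<in> I"
    and D: "\<And>x y. x \<in> A \<Longrightarrow> y \<in> A \<Longrightarrow> sq_dist I x y \<le> D"
    and ne: "{t. x(i := t) \<in> A} \<noteq> {}" "{t. y(i := t) \<in> A} \<noteq> {}"
  shows "emeasure lborel {t. x(i := t) \<in> A} + emeasure lborel {t. y(i := t) \<in> A}
           \<le> ennreal (2 * sqrt (D - sq_dist (I - {i}) x y))"
    and "sq_dist (I - {i}) x y \<le> D"
proof -
  have *: "(a - b)\<^sup>2 \<le> D - sq_dist (I - {i}) x y" if "x(i := a) \<in> A" "y(i := b) \<in> A" for a b
    using D[OF that] sq_dist_fun_upd[OF I] by (smt (verit))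
  show "emeasure lborel {t. x(i := t) \<in> A} + emeasure lborel {t. y(i := t) \<in> A}
           \<le> ennreal (2 * sqrt (D - sq_dist (I - {i}) x y))"
    by (rule emeasure_add_le_of_dist_le[OF ne]) (use * in \<open>auto intro!: real_le_rsqrt\<close>)
  show "sq_dist (I - {i}) x y \<le> D"
    using ne * by (smt (verit, best) Collect_empty_eq zero_le_power2)
qed

text \<open>
  Symmetrization does not increase the diameter. Two fibres \<open>F\<^sub>x\<close> and \<open>F\<^sub>y\<close> of \<open>A\<close> contain points
  whose distance exceeds any number below half the sum of their lengths, and the two symmetrized
  fibres contain no pair of points further apart than that half sum.
\<close>
lemma steiner_sq_dist:
  assumes I: "finite I" "i \<in> I"
    and D: "\<And>x y. x \<in> A \<Longrightarrow> y \<in> A \<Longrightarrow> sq_dist I x y \<le> D"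
    and x: "x \<in> steiner I i A" and y: "y \<in> steiner I i A"
  shows "sq_dist I x y \<le> D"
proof -
  let ?F = "\<lambda>x. {t. x(i := t) \<in> A}"
  let ?w = "sqrt (D - sq_dist (I - {i}) x y)"
  have ne: "?F x \<noteq> {}" "?F y \<noteq> {}"
    using x y by (auto simp only: steiner_def mem_Collect_eq) (metis emeasure_empty not_less_zero)+
  note le = fiber_pair_le[OF I D ne, simplified]
  \<comment> \<open>Membership in the symmetrized set bounds twice each coordinate by the length of its fibre.\<close>
  have "ennreal (2 * \<bar>x i\<bar> + 2 * \<bar>y i\<bar>) = ennreal (2 * \<bar>x i\<bar>) + ennreal (2 * \<bar>y i\<bar>)"
    by (rule ennreal_plus) auto
  also have "\<dots> \<le> emeasure lborel (?F x) + emeasure lborel (?F y)"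
    using x y unfolding steiner_def by (intro add_mono) auto
  also have "\<dots> \<le> ennreal (2 * ?w)" using le(1) by simp
  finally have "2 * \<bar>x i\<bar> + 2 * \<bar>y i\<bar> \<le> 2 * ?w" using le(2) by (subst (asm) ennreal_le_iff) auto
  then have "\<bar>x i - y i\<bar> \<le> ?w" by linarith
  then have "(x i - y i)\<^sup>2 \<le> ?w\<^sup>2" by (meson abs_le_square_iff abs_ge_self order_trans)
  then have "(x i - y i)\<^sup>2 \<le> D - sq_dist (I - {i}) x y" using le(2) by simp
  then show ?thesis using sq_dist_fun_upd[OF I, of x "x i" y "y i"] by simp
qed

text \<open>
  By Fubini, since every fibre keeps its length. The bound on distances makes the fibres bounded, so
  that the symmetrized ones are intervals with finite endpoints.
\<close>
lemma emeasure_steiner: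
  assumes I: "finite I" "i \<in> I" and A: "A \<in> sets (lebPi I)"
    and D: "\<And>x y. x \<in> A \<Longrightarrow> y \<in> A \<Longrightarrow> sq_dist I x y \<le> D"
  shows "emeasure (lebPi I) (steiner I i A) = emeasure (lebPi I) A"
proof -
  interpret product_sigma_finite "\<lambda>_::'a. lborel :: real measure" ..
  have fub: "emeasure (lebPi I) B = (\<integral>\<^sup>+x. emeasure lborel {t. x(i := t) \<in> B} \<partial>lebPi (I - {i}))"
    if B: "B \<in> sets (lebPi I)" for B
  proof -
    have "emeasure (lebPi I) B = (\<integral>\<^sup>+x. indicator B x \<partial>lebPi (insert i (I - {i})))"
      using I B by (simp add: insert_absorb)
    also have "\<dots> = (\<integral>\<^sup>+x. \<integral>\<^sup>+t. indicator B (x(i := t)) \<partial>lborel \<partial>lebPi (I - {i}))"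
      by (rule product_nn_integral_insert) (use I B in \<open>auto simp: insert_absorb\<close>)
    also have "\<dots> = (\<integral>\<^sup>+x. emeasure lborel {t. x(i := t) \<in> B} \<partial>lebPi (I - {i}))"
    proof (rule nn_integral_cong)
      fix x assume x: "x \<in> space (lebPi (I - {i}))"
      have "(\<integral>\<^sup>+t. indicator B (x(i := t)) \<partial>lborel) = (\<integral>\<^sup>+t. indicator {t. x(i := t) \<in> B} t \<partial>lborel)"
        by (simp add: indicator_def)
      then show "(\<integral>\<^sup>+t. indicator B (x(i := t)) \<partial>lborel) = emeasure lborel {t. x(i := t) \<in> B}"
        using fiber_measurable[OF B I(2) disjI1[OF x]] by simp
    qed
    finally show ?thesis .
  qed
  have "emeasure lborel {t. x(i := t) \<in> steiner I i A} = emeasure lborel {t. x(i := t) \<in> A}"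
    if x: "x \<in> space (lebPi (I - {i}))" for x
  proof -
    define m where "m = emeasure lborel {t. x(i := t) \<in> A}"
    have "m \<noteq> \<infinity>"
    proof (cases "{t. x(i := t) \<in> A} = {}")
      case False
      have "m + m < \<infinity>"
        unfolding m_def using order_le_less_trans[OF fiber_pair_le(1)[OF I D False False] ennreal_less_top]
        by simp
      then show ?thesis by auto
    qed (simp add: m_def)
    then obtain u where u: "m = ennreal u" "u \<ge> 0" by (cases m) auto
    have "x(i := t) \<in> space (lebPi I)" for t
      using x I by (auto simp: space_PiM PiE_def extensional_def)
    then have "{t. x(i := t) \<in> steiner I i A} = {t. ennreal (2 * \<bar>t\<bar>) < m}"
      by (auto simp: steiner_def m_def)
    also have "\<dots> = {- u/2 <..< u/2}" by (auto simp: u ennreal_less_iff)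
    also have "emeasure lborel \<dots> = m" using u by simp
    finally show ?thesis by (simp add: m_def)
  qed
  then show ?thesis
    unfolding fub[OF A] fub[OF sets_steiner[OF A I(2)]] by (intro nn_integral_cong) auto
qed

text \<open>
  Symmetrization creates the reflection symmetry in its own direction and keeps those in the other
  directions, because a reflection in another coordinate permutes the fibres.
\<close>
lemma steiner_reflect:
  assumes "i \<in> I" "x \<in> steiner I i A" "j \<in> I" "j = i \<or> (\<forall>x\<in>A. x(j := - x j) \<in> A)"
  shows "x(j := - x j) \<in> steiner I i A"
proof -
  have sp: "x(j := - x j) \<in> space (lebPi I)"
    using assms by (auto simp: steiner_def space_PiM PiE_def extensional_def)
  show ?thesis
  proof (cases "j = i")
    case True
    then show ?thesis using assms sp by (simp add: steiner_def)
  next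
    case False
    have eq: "(x(j := - x j))(i := t) = (x(i := t))(j := - (x(i := t)) j)" for t
      using False by (auto simp: fun_eq_iff)
    have eq2: "x(i := t) = (x(i := t, j := - x j))(j := - (x(i := t, j := - x j)) j)" for t
      using False by (auto simp: fun_eq_iff)
    have "{t. (x(j := - x j))(i := t) \<in> A} = {t. x(i := t) \<in> A}"
      using assms(4) False eq eq2 by (metis (no_types, lifting) fun_upd_other fun_upd_twist)
    then show ?thesis using assms sp False by (simp add: steiner_def)
  qed
qed

lemma exists_symmetrization:
  assumes I: "finite I" and A: "A \<in> sets (lebPi I)"
    and D: "\<And>x y. x \<in> A \<Longrightarrow> y \<in> A \<Longrightarrow> sq_dist I x y \<le> D"
    and J: "finite J" "J \<subseteq> I"
  shows "\<exists>B\<in>sets (lebPi I). emeasure (lebPi I) B = emeasure (lebPi I) A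
           \<and> (\<forall>x\<in>B. \<forall>y\<in>B. sq_dist I x y \<le> D) \<and> (\<forall>j\<in>J. \<forall>x\<in>B. x(j := - x j) \<in> B)"
  using J
proof (induction J)
  case empty
  show ?case by (rule bexI[OF _ A]) (use D in auto)
next
  case (insert i J)
  then have "J \<subseteq> I" by blast
  from insert.IH[OF this]
  obtain B where B: "B \<in> sets (lebPi I)" "emeasure (lebPi I) B = emeasure (lebPi I) A"
      "\<forall>x\<in>B. \<forall>y\<in>B. sq_dist I x y \<le> D" "\<forall>j\<in>J. \<forall>x\<in>B. x(j := - x j) \<in> B"
    by blast
  have i: "i \<in> I" using insert by auto
  show ?case
  proof (intro bexI[of _ "steiner I i B"] conjI ballI)
    show "emeasure (lebPi I) (steiner I i B) = emeasure (lebPi I) A"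
      using emeasure_steiner[OF I i B(1), of D] B by auto
    show "sq_dist I x y \<le> D" if "x \<in> steiner I i B" "y \<in> steiner I i B" for x y
      using steiner_sq_dist[OF I i _ that] B(3) by auto
    show "x(j := - x j) \<in> steiner I i B" if "j \<in> insert i J" "x \<in> steiner I i B" for j x
      using steiner_reflect[OF i that(2)] that B(4) insert.prems by blast
    show "steiner I i B \<in> sets (lebPi I)" by (rule sets_steiner[OF B(1) i])
  qed
qed

text \<open>
  After symmetrization along every axis the set is invariant under each coordinate reflection, hence
  under \<open>x \<mapsto> -x\<close>. Then \<open>x\<close> and \<open>-x\<close> are both in the set, so \<open>2 \<bar>x\<bar>\<close> is at most its diameter,
  and the set lies in the centred ball of that diameter.
\<close>
lemma isodiametric_PiM:
  assumes I: "finite I" and A: "A \<in> sets (lebPi I)"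
    and D: "\<And>x y. x \<in> A \<Longrightarrow> y \<in> A \<Longrightarrow> sq_dist I x y \<le> D"
  shows "emeasure (lebPi I) A \<le> emeasure (lebPi I) {x \<in> space (lebPi I). 4 * (\<Sum>i\<in>I. (x i)\<^sup>2) \<le> D}"
proof -
  obtain B where B: "B \<in> sets (lebPi I)" "emeasure (lebPi I) B = emeasure (lebPi I) A"
      "\<And>x y. x \<in> B \<Longrightarrow> y \<in> B \<Longrightarrow> sq_dist I x y \<le> D"
      "\<And>j x. j \<in> I \<Longrightarrow> x \<in> B \<Longrightarrow> x(j := - x j) \<in> B"
    using exists_symmetrization[OF I A D I order_refl] by blast
  \<comment> \<open>Composing the reflections in the coordinates of \<open>J\<close> one after the other.\<close>
  have refl: "(\<lambda>i. if i \<in> J then - x i else x i) \<in> B" if "finite J" "J \<subseteq> I" "x \<in> B" for J x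
    using that
  proof (induction J)
    case (insert j J)
    let ?y = "\<lambda>i. if i \<in> J then - x i else x i"
    have "?y(j := - ?y j) \<in> B" using insert by (intro B(4)) auto
    also have "?y(j := - ?y j) = (\<lambda>i. if i \<in> insert j J then - x i else x i)"
      using insert by (auto simp: fun_eq_iff)
    finally show ?case .
  qed simp
  have "4 * (\<Sum>i\<in>I. (x i)\<^sup>2) \<le> D" if "x \<in> B" for x
  proof -
    have "sq_dist I x (\<lambda>i. if i \<in> I then - x i else x i) = 4 * (\<Sum>i\<in>I. (x i)\<^sup>2)"
      unfolding sq_dist_def sum_distrib_left by (rule sum.cong) (auto simp: power2_eq_square)
    then show ?thesis using B(3)[OF that refl[OF I order_refl that]] by simp
  qed
  moreover have "B \<subseteq> space (lebPi I)" using B(1) by (rule sets.sets_into_space)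
  ultimately have "B \<subseteq> {x \<in> space (lebPi I). 4 * (\<Sum>i\<in>I. (x i)\<^sup>2) \<le> D}" by auto
  moreover have "{x \<in> space (lebPi I). 4 * (\<Sum>i\<in>I. (x i)\<^sup>2) \<le> D} \<in> sets (lebPi I)"
  proof -
    have [measurable]: "(\<lambda>x. x i) \<in> borel_measurable (lebPi I)" if "i \<in> I" for i
      using measurable_component_singleton[OF that, of "\<lambda>_. lborel"] by simp
    show ?thesis by measurable
  qed
  ultimately show ?thesis unfolding B(2)[symmetric] by (rule emeasure_mono)
qed

theorem isodiametric_inequality:
  fixes A :: "'a::euclidean_space set"
  assumes A: "A \<in> sets borel" and R: "0 \<le> R" and D: "\<And>x y. x \<in> A \<Longrightarrow> y \<in> A \<Longrightarrow> dist x y \<le> 2 * R"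
  shows "emeasure lborel A \<le> ennreal (unit_ball_vol (real DIM('a)) * R ^ DIM('a))"
proof -
  let ?P = "lebPi (Basis :: 'a set)"
  let ?f = "\<lambda>g. \<Sum>b\<in>Basis. g b *\<^sub>R (b :: 'a)"
  have leb: "(lborel :: 'a measure) = distr ?P borel ?f"
    by (rule lborel_eq)
  have fm: "?f \<in> ?P \<rightarrow>\<^sub>M borel" by measurable
  have em: "emeasure lborel B = emeasure ?P (?f -` B \<inter> space ?P)" if "B \<in> sets borel" for B :: "'a set"
    unfolding leb using fm that by (rule emeasure_distr)
  have comp: "?f g \<bullet> b = g b" if "b \<in> Basis" for g b
    using that by (simp add: inner_sum_left inner_Basis if_distrib cong: if_cong)
  have sq: "sq_dist Basis g h = (dist (?f g) (?f h))\<^sup>2" for g h :: "'a \<Rightarrow> real"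
    unfolding sq_dist_def euclidean_dist_l2[of "?f g"] L2_set_def dist_real_def
    by (simp add: comp sum_nonneg)
  have nsq: "(\<Sum>b\<in>Basis. (g b)\<^sup>2) = (norm (?f g))\<^sup>2" for g :: "'a \<Rightarrow> real"
    using sq[of g "\<lambda>_. 0"] by (simp add: sq_dist_def)
  have "emeasure ?P (?f -` A \<inter> space ?P)
      \<le> emeasure ?P {x \<in> space ?P. 4 * (\<Sum>i\<in>Basis. (x i)\<^sup>2) \<le> (2 * R)\<^sup>2}"
  proof (rule isodiametric_PiM)
    show "?f -` A \<inter> space ?P \<in> sets ?P" using measurable_sets[OF fm A] .
    show "sq_dist Basis x y \<le> (2 * R)\<^sup>2" if "x \<in> ?f -` A \<inter> space ?P" "y \<in> ?f -` A \<inter> space ?P" for x y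
      unfolding sq using D that by (intro power_mono) auto
  qed simp
  also have "{x \<in> space ?P. 4 * (\<Sum>i\<in>Basis. (x i)\<^sup>2) \<le> (2 * R)\<^sup>2} = ?f -` cball 0 R \<inter> space ?P"
    unfolding nsq using R by (auto simp: power_mult_distrib intro: power_mono power2_le_imp_le)
  also have "emeasure ?P \<dots> = emeasure lborel (cball (0::'a) R)" by (rule em[symmetric]) simp
  finally show ?thesis using em[OF A] emeasure_cball[OF R, of "0::'a"] by simp
qed

section \<open>Hausdorff outer measure and the unit cube\<close>

lemma hausdorff_delta_mono:
  "A \<subseteq> B \<Longrightarrow> hausdorff_delta t \<delta> A \<le> hausdorff_delta t \<delta> B"
  unfolding hausdorff_delta_def by (rule INF_superset_mono) auto

text \<open>
  Near-optimal covers of the sets \<open>A n\<close>, with errors summing to \<open>e\<close>, are merged into one cover.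
\<close>
lemma hausdorff_delta_UN:
  "hausdorff_delta t \<delta> (\<Union>n. A n) \<le> (\<Sum>n. hausdorff_delta t \<delta> (A n))"
proof (rule ennreal_le_epsilon)
  fix e :: real assume fin: "(\<Sum>n. hausdorff_delta t \<delta> (A n)) < top" and e: "0 < e"
  have "\<exists>U. A n \<subseteq> (\<Union>i. U i) \<and> (\<forall>i. bounded (U i) \<and> diameter (U i) \<le> \<delta>) \<and>
          (\<Sum>i. diam_powr t (U i)) \<le> hausdorff_delta t \<delta> (A n) + ennreal (e * (1/2) ^ Suc n)" for n
  proof -
    have "hausdorff_delta t \<delta> (A n) \<noteq> \<infinity>"
      using ennreal_suminf_lessD[OF fin, of n] by auto
    from INF_approx_ennreal[OF _ hausdorff_delta_def this, of "e * (1/2) ^ Suc n"] e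
    show ?thesis by (auto intro: less_imp_le)
  qed
  then obtain U where U: "\<And>n. A n \<subseteq> (\<Union>i. U n i)" "\<And>n i. bounded (U n i) \<and> diameter (U n i) \<le> \<delta>"
      and Us: "\<And>n. (\<Sum>i. diam_powr t (U n i)) \<le> hausdorff_delta t \<delta> (A n) + ennreal (e * (1/2) ^ Suc n)"
    by metis
  let ?V = "\<lambda>m. case_prod U (prod_decode m)"
  have "(\<Union>n. A n) \<subseteq> (\<Union>m. ?V m)"
  proof
    fix x assume "x \<in> (\<Union>n. A n)"
    then obtain n i where "x \<in> U n i" using U(1) by blast
    then have "x \<in> ?V (prod_encode (n, i))" by simp
    then show "x \<in> (\<Union>m. ?V m)" by (rule UN_I[OF UNIV_I])
  qed
  moreover have "bounded (?V m) \<and> diameter (?V m) \<le> \<delta>" for m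
    using U(2) by (cases "prod_decode m") simp
  ultimately have "hausdorff_delta t \<delta> (\<Union>n. A n) \<le> (\<Sum>m. diam_powr t (?V m))"
    unfolding hausdorff_delta_def by (intro INF_lower) auto
  also have "\<dots> = (\<Sum>n. \<Sum>i. diam_powr t (U n i))"
    using suminf_ennreal_2dimen[of "\<lambda>n. \<Sum>i. diam_powr t (U n i)" "\<lambda>(n, i). diam_powr t (U n i)"]
    by (simp add: case_prod_beta)
  also have "\<dots> \<le> (\<Sum>n. hausdorff_delta t \<delta> (A n) + ennreal (e * (1/2) ^ Suc n))"
    using Us by (intro suminf_le) auto
  also have "\<dots> = (\<Sum>n. hausdorff_delta t \<delta> (A n)) + (\<Sum>n. ennreal (e * (1/2) ^ Suc n))"
    by (rule suminf_add[symmetric]) auto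
  also have "(\<Sum>n. ennreal (e * (1/2) ^ Suc n)) = ennreal e"
  proof -
    have "(\<lambda>n. e * (1/2) ^ Suc n) sums (e * 1)"
      using power_half_series by (rule sums_mult)
    then show ?thesis using e by (subst suminf_ennreal2) (auto simp: sums_iff)
  qed
  finally show "hausdorff_delta t \<delta> (\<Union>n. A n) \<le> (\<Sum>n. hausdorff_delta t \<delta> (A n)) + ennreal e" .
qed

lemma unnormalized_hausdorff_mono:
  "A \<subseteq> B \<Longrightarrow> unnormalized_hausdorff t A \<le> unnormalized_hausdorff t B"
  unfolding unnormalized_hausdorff_def by (intro SUP_mono) (auto intro: hausdorff_delta_mono)

lemma unnormalized_hausdorff_UN:
  "unnormalized_hausdorff t (\<Union>n. A n) \<le> (\<Sum>n. unnormalized_hausdorff t (A n))"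
  unfolding unnormalized_hausdorff_def[of t "\<Union>n. A n"]
proof (rule SUP_least)
  fix \<delta> :: real assume "\<delta> \<in> {0<..}"
  then have "(\<Sum>n. hausdorff_delta t \<delta> (A n)) \<le> (\<Sum>n. unnormalized_hausdorff t (A n))"
    unfolding unnormalized_hausdorff_def by (intro suminf_le SUP_upper) auto
  then show "hausdorff_delta t \<delta> (\<Union>n. A n) \<le> (\<Sum>n. unnormalized_hausdorff t (A n))"
    using hausdorff_delta_UN order_trans by blast
qed

lemma emeasure_closure_le_diam_powr:
  fixes U :: "(real ^ 's) set"
  assumes "bounded U"
  shows "emeasure lborel (closure U)
     \<le> ennreal (unit_ball_vol (real CARD('s)) / 2 ^ CARD('s)) * diam_powr (real CARD('s)) U"
proof (cases "U = {}")
  case False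
  let ?R = "diameter U / 2"
  have R: "0 \<le> ?R" using diameter_ge_0[OF assms] by simp
  have "emeasure lborel (closure U) \<le> ennreal (unit_ball_vol (real DIM(real^'s)) * ?R ^ DIM(real^'s))"
    by (rule isodiametric_inequality[OF _ R])
       (use diameter_bounded_bound[of "closure U"] assms in \<open>auto simp: diameter_closure bounded_closure\<close>)
  also have "\<dots> = ennreal (unit_ball_vol (real CARD('s)) / 2 ^ CARD('s)) * diam_powr (real CARD('s)) U"
    using False R by (simp add: diam_powr_def powr_realpow' ennreal_mult'[symmetric] power_divide)
  finally show ?thesis .
qed simp

text \<open>
  The isodiametric inequality turns any cover of the unit cube into a bound for its volume. The value
  \<open>2^s / \<upsilon>\<^sub>s\<close> is what makes a ball of radius \<open>r\<close>, which has diameter \<open>2 * r\<close>, contribute no more than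
  \<open>\<upsilon>\<^sub>s * r^s\<close> to a cover after normalization by the cube.
\<close>
lemma unnormalized_hausdorff_cube_ge:
  "ennreal (2 ^ CARD('s) / unit_ball_vol (real CARD('s)))
     \<le> unnormalized_hausdorff (real CARD('s)) (cbox 0 1 :: (real ^ 's::finite) set)"
proof -
  let ?n = "CARD('s)"
  let ?k = "unit_ball_vol (real ?n) / 2 ^ ?n"
  have k: "0 < ?k" by simp
  have kk: "ennreal (1 / k) * ennreal k = 1" if "0 < k" for k :: real
    using that by (simp add: ennreal_mult'[symmetric])
  have "ennreal (1 / ?k) \<le> hausdorff_delta (real ?n) 1 (cbox 0 1 :: (real ^ 's) set)"
    unfolding hausdorff_delta_def
  proof (rule INF_greatest, clarify)
    fix U :: "nat \<Rightarrow> (real ^ 's) set"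
    assume cov: "cbox 0 1 \<subseteq> (\<Union>i. U i)" and bd: "\<forall>i. bounded (U i) \<and> diameter (U i) \<le> 1"
    have one: "(1 :: real ^ 's) \<bullet> b = 1" if "b \<in> Basis" for b
      using that by (auto simp: Basis_vec_def inner_axis)
    have "1 = emeasure lborel (cbox 0 1 :: (real ^ 's) set)"
      by (subst emeasure_lborel_cbox) (simp_all add: one)
    also have "\<dots> \<le> emeasure lborel (\<Union>i. closure (U i))"
      by (rule emeasure_mono[OF order_trans[OF cov UN_mono[OF order_refl closure_subset]]]) auto
    also have "\<dots> \<le> (\<Sum>i. emeasure lborel (closure (U i)))"
      by (intro emeasure_subadditive_countably) auto
    also have "\<dots> \<le> (\<Sum>i. ennreal ?k * diam_powr (real ?n) (U i))"
      using bd emeasure_closure_le_diam_powr by (intro suminf_le) auto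
    also have "\<dots> = ennreal ?k * (\<Sum>i. diam_powr (real ?n) (U i))" by simp
    finally have "ennreal (1 / ?k) * 1 \<le> ennreal (1 / ?k) * (ennreal ?k * (\<Sum>i. diam_powr (real ?n) (U i)))"
      by (rule mult_left_mono) simp
    also have "\<dots> = (\<Sum>i. diam_powr (real ?n) (U i))"
      by (simp only: mult.assoc[symmetric] kk[OF k] mult_1)
    finally show "ennreal (1 / ?k) \<le> (\<Sum>i. diam_powr (real ?n) (U i))" by simp
  qed
  also have "\<dots> \<le> unnormalized_hausdorff (real ?n) (cbox 0 1 :: (real ^ 's) set)"
    unfolding unnormalized_hausdorff_def by (rule SUP_upper) simp
  finally show ?thesis by simp
qed

section \<open>Upper densities\<close>

text \<open>
  A Vitali covering argument. Where small balls carry at least the mass \<open>\<tau> * (2 * r)^s\<close>, disjoint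
  balls of this kind have \<open>\<Sum> (2 * r)^s\<close> bounded by \<open>1 / \<tau>\<close> times the total mass. A maximal
  disjoint family covers \<open>E\<close> only after enlarging the balls by the factor \<open>5\<close>, which would spoil the
  constant; but finitely many balls can be kept at their original size, and the enlargement is paid
  only on the tail of a convergent series. This yields the sharp constant.
\<close>
lemma hausdorff_le_of_upper_density:
  fixes E :: "'a::euclidean_space set" and s :: nat
  assumes \<nu>: "finite_measure \<nu>" "sets \<nu> = sets borel"
    and s: "0 < s" and \<tau>: "0 < \<tau>"
    and dens: "\<And>x \<delta>. x \<in> E \<Longrightarrow> 0 < \<delta> \<Longrightarrow>
                 \<exists>r. 0 < r \<and> r < \<delta> \<and> \<tau> * (2 * r) ^ s \<le> measure \<nu> (cball x r)"
  shows "unnormalized_hausdorff (real s) E \<le> ennreal (measure \<nu> UNIV / \<tau>)"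
  unfolding unnormalized_hausdorff_def
proof (rule SUP_least)
  interpret finite_measure \<nu> by (rule \<nu>)
  have sp: "space \<nu> = UNIV" using sets_eq_imp_space_eq[OF \<nu>(2)] by simp
  fix \<delta> :: real assume "\<delta> \<in> {0<..}"
  then have \<delta>: "0 < \<delta>" by simp
  \<comment> \<open>Radii are at most \<open>\<delta> / 10\<close>, so that the fivefold enlargements have diameter at most \<open>\<delta>\<close>.\<close>
  define F where "F = {(x, r). x \<in> E \<and> 0 < r \<and> r \<le> \<delta> / 10 \<and> \<tau> * (2 * r) ^ s \<le> measure \<nu> (cball x r)}"
  have F: "0 < snd i \<and> snd i \<le> \<delta> / 10" if "i \<in> F" for i
    using that by (auto simp: F_def)
  obtain C where C: "countable C" "C \<subseteq> F"
      "pairwise (\<lambda>i j. disjnt (cball (fst i) (snd i)) (cball (fst j) (snd j))) C"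
      "\<And>i. i \<in> F \<Longrightarrow> \<exists>j. j \<in> C \<and> \<not> disjnt (cball (fst i) (snd i)) (cball (fst j) (snd j)) \<and>
          cball (fst i) (snd i) \<subseteq> ball (fst j) (5 * snd j)"
    by (rule Vitali_covering_lemma_cballs_balls[of F snd "\<delta> / 10" fst]) (use F in blast)+
  \<comment> \<open>Covers are sequences, so the countable family is indexed by naturals; unused indices get radius \<open>0\<close> and the empty set.\<close>
  define g where "g = to_nat_on C"
  have g: "inj_on g C" unfolding g_def by (rule inj_on_to_nat_on[OF C(1)])
  define h where "h = inv_into C g"
  have hg: "h (g j) = j" if "j \<in> C" for j unfolding h_def using g that by simp
  have hC: "h n \<in> C" if "n \<in> g ` C" for n using that hg by auto
  define r where "r n = (if n \<in> g ` C then snd (h n) else 0)" for n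
  define B where "B n = (if n \<in> g ` C then cball (fst (h n)) (snd (h n)) else {})" for n
  have r0: "0 \<le> r n" for n
    using F[of "h n"] C(2) hC[of n] unfolding r_def by (auto intro: less_imp_le)
  have hinj: "h n \<noteq> h m" if "n \<in> g ` C" "m \<in> g ` C" "n \<noteq> m" for n m
    using that hg by auto
  have "B n \<inter> B m = {}" if "n \<noteq> m" for n m
  proof (cases "n \<in> g ` C \<and> m \<in> g ` C")
    case True
    then have "disjnt (cball (fst (h n)) (snd (h n))) (cball (fst (h m)) (snd (h m)))"
      using C(3) hC[of n] hC[of m] hinj[of n m] that unfolding pairwise_def by blast
    then show ?thesis by (simp add: B_def disjnt_def)
  qed (auto simp: B_def)
  then have "disjoint_family B" unfolding disjoint_family_on_def by blast
  moreover have Bs: "B n \<in> sets \<nu>" for n unfolding B_def \<nu>(2) by simp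
  ultimately have sB: "(\<lambda>n. measure \<nu> (B n)) sums measure \<nu> (\<Union>n. B n)"
    by (intro finite_measure_UNION) auto
  have le: "(2 * r n) ^ s \<le> measure \<nu> (B n) / \<tau>" for n
  proof (cases "n \<in> g ` C")
    case True
    then have "h n \<in> F" using hC C(2) by blast
    then show ?thesis using True \<tau> unfolding F_def r_def B_def
      by (auto simp: case_prod_beta field_simps)
  qed (use s in \<open>simp add: r_def B_def power_0_left\<close>)
  have sums: "summable (\<lambda>n. (2 * r n) ^ s)"
    by (rule summable_comparison_test[OF _ sums_summable[OF sums_divide[OF sB, of \<tau>]]])
       (use le r0 in auto)
  have "(\<Sum>n. (2 * r n) ^ s) \<le> (\<Sum>n. measure \<nu> (B n) / \<tau>)"
    by (rule suminf_le[OF le sums sums_summable[OF sums_divide[OF sB]]])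
  also have "\<dots> = measure \<nu> (\<Union>n. B n) / \<tau>" using sums_divide[OF sB, of \<tau>] by (simp add: sums_iff)
  also have "\<dots> \<le> measure \<nu> UNIV / \<tau>"
    using \<tau> bounded_measure[of "\<Union>n. B n"] sp by (simp add: divide_right_mono)
  finally have tot: "(\<Sum>n. (2 * r n) ^ s) \<le> measure \<nu> UNIV / \<tau>" .
  have sums10: "summable (\<lambda>n. (10 * r n) ^ s)"
  proof -
    have "(10 * r n) ^ s = 5 ^ s * (2 * r n) ^ s" for n
      using power_mult_distrib[of 5 "2 * r n" s] by simp
    then show ?thesis using summable_mult[OF sums, of "5 ^ s"] by simp
  qed
  show "hausdorff_delta (real s) \<delta> E \<le> ennreal (measure \<nu> UNIV / \<tau>)"
  proof (rule ennreal_le_epsilon)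
    fix e :: real assume e: "0 < e"
    obtain m where m: "norm (\<Sum>n. (10 * r (n + m)) ^ s) < e"
      using suminf_exist_split[OF e sums10] by blast
    define V where "V n = (if n \<in> g ` C then if n < m then B n else cball (fst (h n)) (5 * snd (h n)) else {})" for n
    define c where "c n = (if n < m then 0 else (10 * r n) ^ s)" for n
    have "E \<subseteq> (\<Union>n. V n)"
    proof
      fix x assume x: "x \<in> E"
      let ?W = "\<Union>n<m. B n"
      have "closed ?W" unfolding B_def by auto
      show "x \<in> (\<Union>n. V n)"
      proof (cases "x \<in> ?W")
        case True
        then obtain n where "n < m" "x \<in> B n" by blast
        then have "x \<in> V n" unfolding V_def B_def by (auto split: if_splits)
        then show ?thesis by blast
      next
        case False
        then obtain d where d: "0 < d" "ball x d \<inter> ?W = {}"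
          using \<open>closed ?W\<close> by (metis ComplI disjoint_eq_subset_Compl open_Compl open_contains_ball)
        obtain q where q: "0 < q" "q < min d (\<delta> / 10)" "\<tau> * (2 * q) ^ s \<le> measure \<nu> (cball x q)"
          using dens[OF x, of "min d (\<delta> / 10)"] d \<delta> by auto
        then have "(x, q) \<in> F" using x by (auto simp: F_def)
        then obtain j where j: "j \<in> C" "\<not> disjnt (cball x q) (cball (fst j) (snd j))"
            "cball x q \<subseteq> ball (fst j) (5 * snd j)"
          using C(4)[of "(x, q)"] by auto
        have gj: "g j \<in> g ` C" using j by blast
        \<comment> \<open>A ball around \<open>x\<close> avoiding the first \<open>m\<close> balls can only meet a later one.\<close>
        have "\<not> g j < m"
        proof
          assume "g j < m"
          then have "cball (fst j) (snd j) \<subseteq> ?W" using gj hg[OF j(1)] unfolding B_def by force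
          moreover have "cball x q \<subseteq> ball x d" using q by auto
          ultimately show False using j(2) d(2) unfolding disjnt_def by blast
        qed
        moreover have "x \<in> ball (fst j) (5 * snd j)" using subsetD[OF j(3), of x] q(1) by auto
        ultimately have "x \<in> V (g j)" using gj hg[OF j(1)] by (auto simp: V_def)
        then show ?thesis by blast
      qed
    qed
    moreover have "bounded (V n) \<and> diameter (V n) \<le> \<delta>" for n
    proof (cases "n \<in> g ` C")
      case True
      then have "0 < snd (h n) \<and> 10 * snd (h n) \<le> \<delta>"
        using F[OF subsetD[OF C(2) hC[OF True]]] by linarith
      then show ?thesis using True by (simp add: V_def B_def)
    qed (use \<delta> in \<open>simp add: V_def\<close>)
    ultimately have "hausdorff_delta (real s) \<delta> E \<le> (\<Sum>n. diam_powr (real s) (V n))"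
      unfolding hausdorff_delta_def by (intro INF_lower) auto
    also have "\<dots> \<le> (\<Sum>n. ennreal ((2 * r n) ^ s + c n))"
    proof (intro suminf_le)
      fix n
      show "diam_powr (real s) (V n) \<le> ennreal ((2 * r n) ^ s + c n)"
      proof (cases "n \<in> g ` C")
        case True
        then have "0 < snd (h n)" using F hC C(2) by blast
        then have "diam_powr (real s) (V n) \<le> ennreal (if n < m then (2 * r n) ^ s else (10 * r n) ^ s)"
          using True s unfolding V_def B_def r_def diam_powr_def
          by (auto simp: powr_realpow)
        also have "\<dots> \<le> ennreal ((2 * r n) ^ s + c n)"
          using r0[of n] by (intro ennreal_leI) (auto simp: c_def)
        finally show ?thesis .
      qed (simp add: V_def diam_powr_def)
    qed auto
    also have "\<dots> = ennreal (\<Sum>n. (2 * r n) ^ s + c n)"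
    proof (rule suminf_ennreal2)
      show "0 \<le> (2 * r n) ^ s + c n" for n using r0[of n] by (simp add: c_def)
      show "summable (\<lambda>n. (2 * r n) ^ s + c n)"
        by (rule summable_add[OF sums summable_comparison_test[OF _ sums10]]) (use r0 in \<open>auto simp: c_def\<close>)
    qed
    also have "(\<Sum>n. (2 * r n) ^ s + c n) = (\<Sum>n. (2 * r n) ^ s) + (\<Sum>n. c n)"
      by (rule suminf_add[symmetric, OF sums summable_comparison_test[OF _ sums10]]) (use r0 in \<open>auto simp: c_def\<close>)
    also have "(\<Sum>n. c n) = (\<Sum>n. (10 * r (n + m)) ^ s)"
    proof -
      have "summable c"
        by (rule summable_comparison_test[OF _ sums10]) (use r0 in \<open>auto simp: c_def\<close>)
      from suminf_split_initial_segment[OF this, of m] show ?thesis unfolding c_def by simp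
    qed
    also have "ennreal ((\<Sum>n. (2 * r n) ^ s) + (\<Sum>n. (10 * r (n + m)) ^ s)) \<le> ennreal (measure \<nu> UNIV / \<tau> + e)"
      using tot m by (intro ennreal_leI) auto
    also have "\<dots> = ennreal (measure \<nu> UNIV / \<tau>) + ennreal e"
      using e \<tau> by (intro ennreal_plus) auto
    finally show "hausdorff_delta (real s) \<delta> E \<le> ennreal (measure \<nu> UNIV / \<tau>) + ennreal e" .
  qed
qed

text \<open>
  The upper density of a set of finite measure is at most \<open>1 + \<epsilon>\<close> somewhere, in a form uniform on
  a set of positive outer measure. If all sets \<open>P k\<close> of points whose balls of radius less than \<open>1 / Suc k\<close> carry at
  most \<open>(1 + \<epsilon>) * \<upsilon>\<^sub>s * r^s\<close> were null, then almost all points would have upper density at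
  least \<open>1 + \<epsilon>\<close>, and the covering argument would give \<open>\<H>\<^sub>s K \<le> \<H>\<^sub>s K / (1 + \<epsilon>)\<close>.
\<close>
lemma exists_nonnull_low_density:
  fixes K :: "'a::euclidean_space set"
  assumes K: "K \<in> sets borel"
    and H: "sets H = sets borel" "\<And>A. A \<in> sets borel \<Longrightarrow> emeasure H A = hausdorff TYPE('s::finite) A"
    and fin: "0 < hausdorff TYPE('s) K" "hausdorff TYPE('s) K < \<infinity>"
    and \<epsilon>: "0 < \<epsilon>"
  shows "\<exists>\<delta>>0. 0 < hausdorff TYPE('s)
     {x \<in> K. \<forall>r. 0 < r \<and> r < \<delta> \<longrightarrow>
        measure H (cball x r \<inter> K) \<le> (1 + \<epsilon>) * unit_ball_vol (real CARD('s)) * r ^ CARD('s)}"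
proof (rule ccontr)
  let ?n = "CARD('s)"
  let ?v = "unit_ball_vol (real ?n)"
  let ?U = "unnormalized_hausdorff (real ?n) :: 'a set \<Rightarrow> ennreal"
  define Q where "Q = unnormalized_hausdorff (real ?n) (cbox 0 1 :: (real ^ 's) set)"
  have HQ: "hausdorff TYPE('s) A = ?U A / Q" for A by (simp add: hausdorff_def Q_def)
  have "?U K / Q \<noteq> 0" "?U K / Q \<noteq> top" using fin unfolding HQ by (auto simp: less_top[symmetric])
  then have Q: "Q \<noteq> top" "Q \<noteq> 0" and UK: "?U K \<noteq> 0"
    by (auto simp: ennreal_divide_eq_0_iff ennreal_divide_eq_top_iff)
  define P where "P k = {x \<in> K. \<forall>r. 0 < r \<and> r < 1 / real (Suc k) \<longrightarrow>
        measure H (cball x r \<inter> K) \<le> (1 + \<epsilon>) * ?v * r ^ ?n}" for k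
  assume "\<not> ?thesis"
  then have "hausdorff TYPE('s) (P k) = 0" for k
    unfolding P_def by (auto simp: not_gr_zero dest!: spec[of _ "1 / real (Suc k)"])
  then have P0: "?U (P k) = 0" for k using Q by (auto simp: HQ ennreal_divide_eq_0_iff)
  define E where "E = K - (\<Union>k. P k)"
  \<comment> \<open>The points outside all \<open>P k\<close> form a set \<open>E\<close> of full outer measure.\<close>
  let ?A = "case_nat E P"
  have "?U K \<le> ?U (\<Union>n. ?A n)"
  proof (rule unnormalized_hausdorff_mono, rule subsetI)
    fix x assume "x \<in> K"
    then have "x \<in> ?A 0 \<or> (\<exists>k. x \<in> ?A (Suc k))" by (auto simp: E_def)
    then show "x \<in> (\<Union>n. ?A n)" by blast
  qed
  also have "\<dots> \<le> (\<Sum>n. ?U (?A n))" by (rule unnormalized_hausdorff_UN)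
  also have "\<dots> = (\<Sum>n. if n = 0 then ?U E else 0)"
    by (rule arg_cong[where f = suminf]) (auto simp: fun_eq_iff P0 split: nat.split)
  also have "\<dots> = ?U E" using sums_If_finite_set[of "{0}" "\<lambda>_. ?U E"] by (simp add: sums_iff)
  finally have KE: "?U K \<le> ?U E" .
  define \<nu> where "\<nu> = density H (indicator K)"
  have KH: "K \<in> sets H" using K H by simp
  have spH: "space H = UNIV" using sets_eq_imp_space_eq[OF H(1)] by simp
  have em\<nu>: "emeasure \<nu> A = emeasure H (K \<inter> A)" if "A \<in> sets borel" for A
    unfolding \<nu>_def using KH that H(1) by (intro emeasure_restricted) auto
  have fin\<nu>: "finite_measure \<nu>"
    by (rule finite_measureI) (use em\<nu>[of UNIV] H(2)[OF K] fin spH in \<open>auto simp: \<nu>_def\<close>)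
  have m\<nu>: "measure \<nu> A = measure H (A \<inter> K)" if "A \<in> sets borel" for A
    using em\<nu>[OF that] by (simp add: measure_def Int_commute)
  define \<tau> where "\<tau> = (1 + \<epsilon>) * ?v / 2 ^ ?n"
  have \<tau>: "0 < \<tau>" using \<epsilon> by (simp add: \<tau>_def)
  have "?U E \<le> ennreal (measure \<nu> UNIV / \<tau>)"
  proof (rule hausdorff_le_of_upper_density[OF fin\<nu> _ _ \<tau>])
    show "sets \<nu> = sets borel" by (simp add: \<nu>_def H)
    show "0 < CARD('s)" by simp
    fix x and \<delta> :: real assume x: "x \<in> E" and "0 < \<delta>"
    then obtain k where k: "1 / real (Suc k) < \<delta>" using nat_approx_posE by metis
    from x have "x \<in> K" "x \<notin> P k" by (auto simp: E_def)
    then obtain r where r: "0 < r" "r < 1 / real (Suc k)" "measure H (cball x r \<inter> K) > (1 + \<epsilon>) * ?v * r ^ ?n"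
      by (auto simp: P_def not_le)
    have "\<tau> * (2 * r) ^ ?n = (1 + \<epsilon>) * ?v * r ^ ?n" by (simp add: \<tau>_def power_mult_distrib)
    then have "\<tau> * (2 * r) ^ ?n \<le> measure \<nu> (cball x r)"
      using r(3) m\<nu>[of "cball x r"] by (simp only: borel_closed closed_cball)
    then show "\<exists>r. 0 < r \<and> r < \<delta> \<and> \<tau> * (2 * r) ^ ?n \<le> measure \<nu> (cball x r)"
      using r k by (intro exI[of _ r]) auto
  qed
  also have "measure \<nu> UNIV = measure H K" using m\<nu>[of UNIV] by simp
  finally have 1: "?U K \<le> ennreal (measure H K / \<tau>)" using KE by simp
  define u where "u = enn2real (?U K)"
  define w where "w = enn2real Q"
  have "?U K < top" using 1 ennreal_less_top order_le_less_trans by blast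
  then have u: "?U K = ennreal u" unfolding u_def by simp
  have u0: "0 < u" using UK unfolding u by (simp add: ennreal_eq_0_iff not_le)
  have w: "Q = ennreal w" using Q(1) unfolding w_def by (simp add: less_top[symmetric])
  have w0: "0 < w" using Q(2) unfolding w by (simp add: ennreal_eq_0_iff not_le)
  have "measure H K = u / w"
    unfolding measure_def H(2)[OF K] HQ u w using u0 w0 by (simp add: divide_ennreal)
  then have "u \<le> u / w / \<tau>" using 1 u0 w0 \<tau> unfolding u by (simp add: ennreal_le_iff)
  then have "w * \<tau> \<le> 1" using u0 w0 \<tau> by (simp add: field_simps)
  moreover have "2 ^ ?n / ?v \<le> w"
    using unnormalized_hausdorff_cube_ge[where 's = 's] w0 unfolding Q_def[symmetric] w by simp
  then have "(2 ^ ?n / ?v) * \<tau> \<le> w * \<tau>" using \<tau> by (intro mult_right_mono) auto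
  moreover have "(2 ^ ?n / ?v) * \<tau> = 1 + \<epsilon>"
  proof -
    have "0 < ?v" by (rule unit_ball_vol_pos) simp
    then have "?v \<noteq> 0" by linarith
    then show ?thesis unfolding \<tau>_def by (simp add: field_simps)
  qed
  ultimately show False using \<epsilon> by linarith
qed

section \<open>Separated sets and the covering radius\<close>

definition separated :: "real \<Rightarrow> 'a::metric_space set \<Rightarrow> bool" where
  "separated h F \<longleftrightarrow> (\<forall>x\<in>F. \<forall>y\<in>F. x \<noteq> y \<longrightarrow> h < dist x y)"

lemma separated_disjoint_cball:
  assumes "separated h F"
  shows "disjoint_family_on (\<lambda>z. cball z (h / 2)) F"
  unfolding disjoint_family_on_def
proof (intro ballI impI equals0I)
  fix x y z assume "x \<in> F" "y \<in> F" "x \<noteq> y" "z \<in> cball x (h / 2) \<inter> cball y (h / 2)"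
  then have "dist x z \<le> h / 2" "dist y z \<le> h / 2" "h < dist x y"
    using assms by (auto simp: separated_def)
  then show False using dist_triangle2[of x y z] by linarith
qed

lemma separated_card_le:
  assumes "finite_measure \<mu>" "sets \<mu> = sets borel" "finite F" "separated h F"
    and b: "\<And>z. z \<in> F \<Longrightarrow> b \<le> measure \<mu> (cball z (h / 2))"
    and A: "(\<Union>z\<in>F. cball z (h / 2)) \<subseteq> A" "A \<in> sets borel"
  shows "real (card F) * b \<le> measure \<mu> A"
proof -
  interpret finite_measure \<mu> by fact
  have "real (card F) * b = (\<Sum>z\<in>F. b)" by simp
  also have "\<dots> \<le> (\<Sum>z\<in>F. measure \<mu> (cball z (h / 2)))" by (intro sum_mono b)
  also have "\<dots> = measure \<mu> (\<Union>z\<in>F. cball z (h / 2))"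
    by (rule finite_measure_finite_Union[symmetric, OF \<open>finite F\<close> _ separated_disjoint_cball[OF assms(4)]])
       (auto simp: assms(2))
  also have "\<dots> \<le> measure \<mu> A" using A assms(2) by (intro finite_measure_mono) auto
  finally show ?thesis .
qed

text \<open>
  Separated sets have bounded cardinality because the balls of radius \<open>h / 2\<close> around their points
  are disjoint and heavy. A separated subset of maximal cardinality is an \<open>h\<close>-net.
\<close>
lemma exists_maximal_separated:
  assumes "finite_measure \<mu>" "sets \<mu> = sets borel" "0 < b" "0 < h"
    and b: "\<And>z. z \<in> A \<Longrightarrow> b \<le> measure \<mu> (cball z (h / 2))"
  shows "\<exists>F. finite F \<and> F \<subseteq> A \<and> separated h F \<and> A \<subseteq> (\<Union>z\<in>F. cball z h)"
proof -
  let ?P = "\<lambda>F. finite F \<and> F \<subseteq> A \<and> separated h F"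
  have "real (card F) \<le> measure \<mu> UNIV / b" if "?P F" for F
    using separated_card_le[OF assms(1,2), of F h b UNIV] that b \<open>0 < b\<close>
    by (auto simp: field_simps)
  then have "\<forall>F. ?P F \<longrightarrow> card F < Suc (nat \<lfloor>measure \<mu> UNIV / b\<rfloor>)"
    by (metis le_nat_floor less_Suc_eq_le)
  moreover have "?P {}" by (simp add: separated_def)
  ultimately obtain F where F: "?P F" "\<And>G. ?P G \<Longrightarrow> card G \<le> card F"
    using ex_has_greatest_nat[of ?P "{}" card "Suc (nat \<lfloor>measure \<mu> UNIV / b\<rfloor>)"] by auto
  have "A \<subseteq> (\<Union>z\<in>F. cball z h)"
  proof
    fix y assume y: "y \<in> A"
    show "y \<in> (\<Union>z\<in>F. cball z h)"
    proof (rule ccontr)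
      assume n: "\<not> ?thesis"
      then have far: "h < dist z y" if "z \<in> F" for z using that by (auto simp: not_le)
      then have "y \<notin> F" using \<open>0 < h\<close> by force
      have "?P (insert y F)"
        using F(1) y far by (auto simp: separated_def dist_commute)
      then show False using F(2)[of "insert y F"] F(1) \<open>y \<notin> F\<close> by auto
    qed
  qed
  then show ?thesis using F(1) by blast
qed

lemma covering_radius_le_iff:
  assumes "finite S" "S \<noteq> {}" "bounded K" "K \<noteq> {}"
  shows "covering_radius S K \<le> a \<longleftrightarrow> (\<forall>y\<in>K. \<exists>x\<in>S. dist y x \<le> a)"
proof -
  obtain x where x: "x \<in> S" using assms by blast
  obtain e where e: "\<And>y. y \<in> K \<Longrightarrow> dist x y \<le> e" using assms(3) bounded_any_center by metis
  have "bdd_above ((\<lambda>y. MIN x\<in>S. norm (y - x)) ` K)"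
  proof (rule bdd_aboveI2)
    fix y assume "y \<in> K"
    have "(MIN x\<in>S. norm (y - x)) \<le> norm (y - x)" using assms x by (intro Min_le) auto
    also have "\<dots> \<le> e" using e[OF \<open>y \<in> K\<close>] by (simp add: dist_norm norm_minus_commute)
    finally show "(MIN x\<in>S. norm (y - x)) \<le> e" .
  qed
  then show ?thesis
    unfolding covering_radius_def using assms by (subst cSUP_le_iff) (auto simp: Min_le_iff dist_norm)
qed

section \<open>A sample of fixed size\<close>

locale random_cover = prob_space M for M :: "'w measure" +
  fixes X :: "nat \<Rightarrow> 'w \<Rightarrow> real ^ 'd" and N :: nat and \<mu> :: "(real ^ 'd) measure" and K :: "(real ^ 'd) set"
  assumes indep: "indep_vars (\<lambda>_. borel) X {1..N}"
    and law: "\<And>j. j \<in> {1..N} \<Longrightarrow> distr M borel (X j) = \<mu>"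
    and N: "1 \<le> N"
    and K: "compact K" "K \<noteq> {}"
    and \<mu>K: "measure \<mu> K = 1"
begin

lemma X_measurable: "j \<in> {1..N} \<Longrightarrow> X j \<in> borel_measurable M"
  using indep unfolding indep_vars_def2 by auto

lemma sets_\<mu>: "sets \<mu> = sets borel"
  using law[of 1] N by (metis atLeastAtMost_iff order_refl sets_distr)

lemma prob_space_\<mu>: "prob_space \<mu>"
  using law[of 1] prob_space_distr[OF X_measurable[of 1]] N by simp

lemma prob_X_in:
  assumes "j \<in> {1..N}" "S \<in> sets borel"
  shows "prob (X j -` S \<inter> space M) = measure \<mu> S"
  using measure_distr[OF X_measurable[OF assms(1)] assms(2)] law[OF assms(1)] by simp

definition missed :: "(real ^ 'd) set \<Rightarrow> 'w set" where
  "missed S = {\<omega> \<in> space M. \<forall>j\<in>{1..N}. X j \<omega> \<notin> S}"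

lemma missed_eq: "missed S = (\<Inter>j\<in>{1..N}. X j -` (- S) \<inter> space M)"
  using N by (auto simp: missed_def)

lemma missed_sets [measurable]:
  assumes "S \<in> sets borel" shows "missed S \<in> sets M"
  unfolding missed_eq
proof (rule sets.finite_INT)
  show "X j -` (- S) \<inter> space M \<in> sets M" if "j \<in> {1..N}" for j
    using measurable_sets[OF X_measurable[OF that], of "- S"] assms by simp
qed (use N in auto)

lemma prob_missed:
  assumes S: "S \<in> sets borel"
  shows "prob (missed S) = (1 - measure \<mu> S) ^ N"
proof -
  interpret \<mu>: prob_space \<mu> by (rule prob_space_\<mu>)
  have "prob (missed S) = (\<Prod>j\<in>{1..N}. prob (X j -` (- S) \<inter> space M))"
    unfolding missed_eq by (rule indep_varsD[OF indep]) (use N S in auto)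
  also have "\<dots> = (\<Prod>j\<in>{1..N}. 1 - measure \<mu> S)"
  proof (rule prod.cong)
    fix j assume j: "j \<in> {1..N}"
    have "space \<mu> = UNIV" using sets_eq_imp_space_eq[OF sets_\<mu>] by simp
    then have "measure \<mu> (- S) = 1 - measure \<mu> S"
      using \<mu>.prob_compl[of S] S sets_\<mu> by (simp add: Compl_eq_Diff_UNIV)
    then show "prob (X j -` (- S) \<inter> space M) = 1 - measure \<mu> S"
      using prob_X_in[OF j, of "- S"] S by simp
  qed simp
  finally show ?thesis by simp
qed

lemma prob_missed_le:
  assumes "S \<in> sets borel" "q \<le> measure \<mu> S"
  shows "prob (missed S) \<le> exp (- (real N * q))"
proof -
  interpret \<mu>: prob_space \<mu> by (rule prob_space_\<mu>)
  have "1 - measure \<mu> S \<le> exp (- q)" using exp_ge_add_one_self[of "- q"] assms(2) by linarith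
  then have "(1 - measure \<mu> S) ^ N \<le> exp (- q) ^ N"
    by (rule power_mono) simp
  then show ?thesis using prob_missed[OF assms(1)] by (simp add: exp_of_nat_mult[symmetric])
qed

text \<open>
  Second moment method. Let \<open>Z\<close> count the sets that are missed by the sample, so that \<open>Z\<close> has
  expectation \<open>m\<close>. For disjoint sets the events of being missed are negatively correlated, since
  \<open>1 - a - b \<le> (1 - a) * (1 - b)\<close>; hence the variance of \<open>Z\<close> is at most \<open>m\<close>, and Chebyshev's
  inequality bounds the probability of \<open>Z = 0\<close> by \<open>1 / m\<close>.
\<close>
lemma prob_some_missed_ge:
  assumes F: "finite F" and B: "\<And>z. z \<in> F \<Longrightarrow> B z \<in> sets borel" "disjoint_family_on B F"
    and m: "m = (\<Sum>z\<in>F. (1 - measure \<mu> (B z)) ^ N)" "0 < m"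
  shows "1 - 1 / m \<le> prob (\<Union>z\<in>F. missed (B z))"
proof -
  interpret \<mu>: prob_space \<mu> by (rule prob_space_\<mu>)
  let ?A = "\<lambda>z. missed (B z)"
  let ?b = "\<lambda>z. measure \<mu> (B z)"
  let ?Z = "\<lambda>\<omega>. (\<Sum>z\<in>F. indicator (?A z) \<omega>) :: real"
  let ?U = "\<Union>z\<in>F. ?A z"
  have A [measurable]: "?A z \<in> sets M" if "z \<in> F" for z using B(1)[OF that] by measurable
  have U [measurable]: "?U \<in> sets M" using F A by blast
  have mA: "m = (\<Sum>z\<in>F. prob (?A z))" unfolding m(1) using B(1) by (intro sum.cong) (auto simp: prob_missed)
  have pair: "prob (?A z \<inter> ?A w) \<le> prob (?A z) * prob (?A w) + (if z = w then prob (?A z) else 0)"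
    if zw: "z \<in> F" "w \<in> F" for z w
  proof (cases "z = w")
    case True
    then show ?thesis by simp
  next
    case False
    have dj: "B z \<inter> B w = {}" using B(2) zw False unfolding disjoint_family_on_def by blast
    have un: "measure \<mu> (B z \<union> B w) = ?b z + ?b w"
      by (rule \<mu>.finite_measure_Union) (use B(1) zw dj sets_\<mu> in auto)
    have "prob (?A z \<inter> ?A w) = prob (missed (B z \<union> B w))"
      by (rule arg_cong[where f = prob]) (auto simp: missed_def)
    also have "\<dots> = (1 - (?b z + ?b w)) ^ N" using B(1) zw un by (subst prob_missed) auto
    also have "\<dots> \<le> ((1 - ?b z) * (1 - ?b w)) ^ N"
      using un \<mu>.prob_le_1[of "B z \<union> B w"] by (intro power_mono) (auto simp: algebra_simps)
    also have "\<dots> = prob (?A z) * prob (?A w)" using B(1) zw by (simp add: prob_missed power_mult_distrib)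
    finally show ?thesis using False by simp
  qed
  \<comment> \<open>Where no set is missed, \<open>Z\<close> vanishes and \<open>(Z - m)\<^sup>2 = m\<^sup>2\<close>.\<close>
  have "m\<^sup>2 * (1 - prob ?U) = expectation (\<lambda>\<omega>. m\<^sup>2 * indicator (space M - ?U) \<omega>)"
    using prob_compl[OF U] by (simp add: emeasure_eq_measure)
  also have "\<dots> \<le> expectation (\<lambda>\<omega>. (\<Sum>z\<in>F. \<Sum>w\<in>F. indicator (?A z \<inter> ?A w) \<omega>) - 2 * m * ?Z \<omega> + m\<^sup>2)"
  proof (rule integral_mono)
    show "integrable M (\<lambda>\<omega>. m\<^sup>2 * indicator (space M - ?U) \<omega>)"
      by (intro integrable_mult_right integrable_real_indicator) (auto simp: emeasure_eq_measure)
    show "integrable M (\<lambda>\<omega>. (\<Sum>z\<in>F. \<Sum>w\<in>F. indicator (?A z \<inter> ?A w) \<omega>) - 2 * m * ?Z \<omega> + m\<^sup>2)"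
      by (intro Bochner_Integration.integrable_add Bochner_Integration.integrable_diff
          Bochner_Integration.integrable_sum integrable_mult_right integrable_real_indicator)
         (auto simp: emeasure_eq_measure)
    fix \<omega> assume "\<omega> \<in> space M"
    have "(\<Sum>z\<in>F. \<Sum>w\<in>F. indicator (?A z \<inter> ?A w) \<omega>) = ?Z \<omega> * ?Z \<omega>"
      by (simp add: sum_product indicator_inter_arith)
    then have eq: "(\<Sum>z\<in>F. \<Sum>w\<in>F. indicator (?A z \<inter> ?A w) \<omega>) - 2 * m * ?Z \<omega> + m\<^sup>2 = (?Z \<omega> - m)\<^sup>2"
      by (simp add: power2_eq_square algebra_simps)
    show "m\<^sup>2 * indicator (space M - ?U) \<omega> \<le> (\<Sum>z\<in>F. \<Sum>w\<in>F. indicator (?A z \<inter> ?A w) \<omega>) - 2 * m * ?Z \<omega> + m\<^sup>2"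
    proof (cases "\<omega> \<in> ?U")
      case True
      then show ?thesis unfolding eq by simp
    next
      case False
      then have "?Z \<omega> = 0" by (intro sum.neutral) auto
      then show ?thesis unfolding eq by (simp add: indicator_def)
    qed
  qed
  also have "\<dots> = (\<Sum>z\<in>F. \<Sum>w\<in>F. prob (?A z \<inter> ?A w)) - 2 * m * m + m\<^sup>2"
  proof -
    have i1: "integrable M (\<lambda>\<omega>. indicator (?A z \<inter> ?A w) \<omega> :: real)" if "z \<in> F" "w \<in> F" for z w
      using that by (intro integrable_real_indicator) (auto simp: emeasure_eq_measure)
    have i2: "integrable M (\<lambda>\<omega>. indicator (?A z) \<omega> :: real)" if "z \<in> F" for z
      using that by (intro integrable_real_indicator) (auto simp: emeasure_eq_measure)
    have e1: "expectation (\<lambda>\<omega>. \<Sum>z\<in>F. \<Sum>w\<in>F. indicator (?A z \<inter> ?A w) \<omega>) = (\<Sum>z\<in>F. \<Sum>w\<in>F. prob (?A z \<inter> ?A w))"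
      using i1 A by (simp add: Bochner_Integration.integral_sum sets.Int)
    have e2: "expectation ?Z = m"
      unfolding mA using i2 A by (simp add: Bochner_Integration.integral_sum)
    have "expectation (\<lambda>\<omega>. (\<Sum>z\<in>F. \<Sum>w\<in>F. indicator (?A z \<inter> ?A w) \<omega>) - 2 * m * ?Z \<omega> + m\<^sup>2)
       = expectation (\<lambda>\<omega>. \<Sum>z\<in>F. \<Sum>w\<in>F. indicator (?A z \<inter> ?A w) \<omega>) - expectation (\<lambda>\<omega>. 2 * m * ?Z \<omega>)
           + expectation (\<lambda>_. m\<^sup>2)"
      using i1 i2 by (subst Bochner_Integration.integral_add Bochner_Integration.integral_diff;
         (intro Bochner_Integration.integrable_diff Bochner_Integration.integrable_sum integrable_mult_right)?; simp)+
    then show ?thesis unfolding e1 by (simp add: e2 prob_space)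
  qed
  also have "\<dots> \<le> (\<Sum>z\<in>F. \<Sum>w\<in>F. prob (?A z) * prob (?A w) + (if z = w then prob (?A z) else 0)) - 2 * m * m + m\<^sup>2"
    using pair by (intro add_right_mono diff_right_mono sum_mono) auto
  also have "(\<Sum>z\<in>F. \<Sum>w\<in>F. prob (?A z) * prob (?A w) + (if z = w then prob (?A z) else 0)) = m * m + m"
    unfolding mA sum_product using F by (simp add: sum.distrib sum.delta)
  finally have "m\<^sup>2 * (1 - prob ?U) \<le> m" by (simp add: power2_eq_square)
  then have "m * (1 - prob ?U) \<le> 1" using m(2) by (simp add: power2_eq_square mult.assoc)
  then show ?thesis using m(2) by (simp add: field_simps)
qed

definition \<rho> :: "'w \<Rightarrow> real" where
  "\<rho> \<omega> = covering_radius ((\<lambda>j. X j \<omega>) ` {1..N}) K"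

lemma \<rho>_le_iff: "\<rho> \<omega> \<le> a \<longleftrightarrow> (\<forall>y\<in>K. \<exists>j\<in>{1..N}. dist y (X j \<omega>) \<le> a)"
  unfolding \<rho>_def using N K by (subst covering_radius_le_iff) (auto simp: compact_imp_bounded)

lemma \<rho>_nonneg: "0 \<le> \<rho> \<omega>"
proof -
  obtain y where "y \<in> K" using K by blast
  then obtain j where "dist y (X j \<omega>) \<le> \<rho> \<omega>" using \<rho>_le_iff[of \<omega> "\<rho> \<omega>"] by auto
  then show ?thesis using zero_le_dist order_trans by blast
qed

text \<open>
  It is enough to test the covering condition on a countable dense subset of \<open>K\<close>, because a finite
  union of closed balls is closed.
\<close>
lemma \<rho>_measurable [measurable]: "\<rho> \<in> borel_measurable M"
proof (rule borel_measurableI_le)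
  fix a
  obtain D where D: "countable D" "D \<subseteq> K" "K \<subseteq> closure D" using separable by metis
  have "\<rho> \<omega> \<le> a \<longleftrightarrow> (\<forall>y\<in>D. \<exists>j\<in>{1..N}. dist y (X j \<omega>) \<le> a)" for \<omega>
  proof
    assume *: "\<forall>y\<in>D. \<exists>j\<in>{1..N}. dist y (X j \<omega>) \<le> a"
    have "closure D \<subseteq> (\<Union>j\<in>{1..N}. cball (X j \<omega>) a)"
      by (rule closure_minimal) (use * in \<open>auto simp: dist_commute\<close>)
    then show "\<rho> \<omega> \<le> a" using D(3) unfolding \<rho>_le_iff by (fastforce simp: dist_commute)
  next
    assume "\<rho> \<omega> \<le> a"
    then show "\<forall>y\<in>D. \<exists>j\<in>{1..N}. dist y (X j \<omega>) \<le> a" unfolding \<rho>_le_iff using D(2) by blast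
  qed
  moreover have "D \<noteq> {}" using D(3) K(2) by auto
  ultimately have "{\<omega> \<in> space M. \<rho> \<omega> \<le> a} = (\<Inter>y\<in>D. {\<omega> \<in> space M. \<exists>j\<in>{1..N}. dist y (X j \<omega>) \<le> a})"
    by auto
  also have "\<dots> \<in> sets M"
  proof (rule sets.countable_INT'[OF D(1) \<open>D \<noteq> {}\<close>], safe)
    fix y
    have "{\<omega> \<in> space M. dist y (X j \<omega>) \<le> a} \<in> sets M" if "j \<in> {1..N}" for j
      using X_measurable[OF that] by measurable
    then show "{\<omega> \<in> space M. \<exists>j\<in>{1..N}. dist y (X j \<omega>) \<le> a} \<in> sets M"
      by (intro sets.sets_Collect_finite_Ex) auto
  qed
  finally show "{\<omega> \<in> space M. \<rho> \<omega> \<le> a} \<in> sets M" .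
qed

lemma AE_\<rho>_le_diameter: "AE \<omega> in M. \<rho> \<omega> \<le> diameter K"
proof -
  have "AE \<omega> in M. X 1 \<omega> \<in> K"
  proof -
    have "prob (X 1 -` K \<inter> space M) = 1"
      using prob_X_in[of 1 K] N K(1) \<mu>K by (simp add: compact_imp_closed borel_closed)
    then have "AE \<omega> in M. \<omega> \<in> X 1 -` K \<inter> space M" by (rule AE_prob_1)
    then show ?thesis by auto
  qed
  then show ?thesis
  proof eventually_elim
    case (elim \<omega>)
    show ?case unfolding \<rho>_le_iff
      using elim N diameter_bounded_bound[OF compact_imp_bounded[OF K(1)]] by fastforce
  qed
qed

text \<open>
  A point of \<open>K\<close> further than \<open>h + r\<close> from the sample lies within \<open>h\<close> of a point of the net, and the
  ball of radius \<open>r\<close> around that point contains no sample point.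
\<close>
lemma prob_\<rho>_gt_le_sum:
  assumes F: "finite F" and cov: "K \<subseteq> (\<Union>z\<in>F. cball z h)"
  shows "prob {\<omega> \<in> space M. h + r < \<rho> \<omega>} \<le> (\<Sum>z\<in>F. prob (missed (cball z r)))"
proof -
  have "{\<omega> \<in> space M. h + r < \<rho> \<omega>} \<subseteq> (\<Union>z\<in>F. missed (cball z r))"
  proof safe
    fix \<omega> assume \<omega>: "\<omega> \<in> space M" "h + r < \<rho> \<omega>"
    then obtain y where y: "y \<in> K" "\<And>j. j \<in> {1..N} \<Longrightarrow> h + r < dist y (X j \<omega>)"
      using \<rho>_le_iff[of \<omega> "h + r"] by (auto simp: not_le)
    then obtain z where z: "z \<in> F" "dist z y \<le> h" using cov by auto
    have "X j \<omega> \<notin> cball z r" if "j \<in> {1..N}" for j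
      using y(2)[OF that] z(2) dist_triangle[of y "X j \<omega>" z] by (simp add: dist_commute)
    then have "\<omega> \<in> missed (cball z r)" using \<omega> by (simp add: missed_def)
    then show "\<omega> \<in> (\<Union>z\<in>F. missed (cball z r))" using z by blast
  qed
  then have "prob {\<omega> \<in> space M. h + r < \<rho> \<omega>} \<le> prob (\<Union>z\<in>F. missed (cball z r))"
    using F by (intro finite_measure_mono) auto
  also have "\<dots> \<le> (\<Sum>z\<in>F. prob (missed (cball z r)))"
    using F by (intro finite_measure_subadditive_finite) auto
  finally show ?thesis .
qed

text \<open>
  The union bound over a net, split in two. Net points away from \<open>T\<close> are numerous, at most
  \<open>1 / (c * (h / 2)^s)\<close>, but their balls have the sharp lower mass bound \<open>q * r^s\<close>. Net points within
  \<open>r\<close> of \<open>T\<close> have only the crude bound \<open>c * r^s\<close>, but their number stays bounded as long as \<open>h\<close> and \<open>r\<close>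
  are comparable: around each point of \<open>T\<close> disjoint balls of radius \<open>h / 2\<close> are packed into a ball
  of radius \<open>2 * r\<close>.
\<close>
lemma prob_\<rho>_gt_le:
  assumes c: "0 < c" "\<And>x r. x \<in> K \<Longrightarrow> 0 < r \<Longrightarrow> r < r0 \<Longrightarrow> c * r ^ s \<le> measure \<mu> (cball x r)"
    and C: "\<And>x r. x \<in> K \<Longrightarrow> 0 < r \<Longrightarrow> r < r0 \<Longrightarrow> measure \<mu> (cball x r) \<le> C * r ^ s"
    and T: "finite T" "T \<subseteq> K" "\<And>y. y \<in> K - (\<Union>t\<in>T. cball t r) \<Longrightarrow> q * r ^ s \<le> measure \<mu> (cball y r)"
    and hr: "0 < h" "h \<le> r" "2 * r < r0"
  shows "prob {\<omega> \<in> space M. h + r < \<rho> \<omega>}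
     \<le> exp (- (real N * (q * r ^ s))) / (c * (h / 2) ^ s)
       + real (card T) * (C * (2 * r) ^ s / (c * (h / 2) ^ s)) * exp (- (real N * (c * r ^ s)))"
proof -
  interpret \<mu>: prob_space \<mu> by (rule prob_space_\<mu>)
  define b where "b = c * (h / 2) ^ s"
  have b0: "0 < b" using c hr by (simp add: b_def)
  have b: "b \<le> measure \<mu> (cball z (h / 2))" if "z \<in> K" for z
    unfolding b_def using that hr by (intro c(2)) auto
  obtain F where F: "finite F" "F \<subseteq> K" "separated h F" "K \<subseteq> (\<Union>z\<in>F. cball z h)"
    using exists_maximal_separated[where A = K, OF \<mu>.finite_measure_axioms sets_\<mu> b0 hr(1) b] by blast
  note card_le = separated_card_le[OF \<mu>.finite_measure_axioms sets_\<mu> _ _ b]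
  have card_F: "real (card F) \<le> 1 / b"
  proof -
    have "real (card F) * b \<le> measure \<mu> UNIV" using F by (intro card_le) auto
    also have "\<dots> \<le> 1" by simp
    finally show ?thesis using b0 by (simp add: field_simps)
  qed
  have card_T: "real (card (F \<inter> cball t r)) \<le> C * (2 * r) ^ s / b" if "t \<in> T" for t
  proof -
    have "real (card (F \<inter> cball t r)) * b \<le> measure \<mu> (cball t (2 * r))"
    proof (rule card_le)
      show "separated h (F \<inter> cball t r)" using F(3) by (auto simp: separated_def)
      show "(\<Union>z\<in>F \<inter> cball t r. cball z (h / 2)) \<subseteq> cball t (2 * r)"
      proof safe
        fix z x assume "z \<in> cball t r" "x \<in> cball z (h / 2)"
        then show "x \<in> cball t (2 * r)" using dist_triangle[of t x z] hr by simp
      qed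
    qed (use F in auto)
    also have "\<dots> \<le> C * (2 * r) ^ s" using that T hr by (intro C) auto
    finally show ?thesis using b0 by (simp add: field_simps)
  qed
  let ?N = "\<Union>t\<in>T. F \<inter> cball t r"
  have finN: "finite ?N" using F(1) T(1) by blast
  have sp: "F = (F - ?N) \<union> ?N" by blast
  have "prob {\<omega> \<in> space M. h + r < \<rho> \<omega>} \<le> (\<Sum>z\<in>F. prob (missed (cball z r)))"
    by (rule prob_\<rho>_gt_le_sum[OF F(1,4)])
  also have "\<dots> = (\<Sum>z\<in>F - ?N. prob (missed (cball z r))) + (\<Sum>z\<in>?N. prob (missed (cball z r)))"
    by (subst sp, rule sum.union_disjoint) (use F(1) finN in auto)
  also have "\<dots> \<le> (\<Sum>z\<in>F - ?N. exp (- (real N * (q * r ^ s)))) + (\<Sum>z\<in>?N. exp (- (real N * (c * r ^ s))))"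
  proof (intro add_mono sum_mono prob_missed_le)
    show "q * r ^ s \<le> measure \<mu> (cball z r)" if "z \<in> F - ?N" for z
      using that F(2) by (intro T(3)) auto
    show "c * r ^ s \<le> measure \<mu> (cball z r)" if "z \<in> ?N" for z
      using that F(2) hr by (intro c(2)) auto
  qed auto
  also have "\<dots> = real (card (F - ?N)) * exp (- (real N * (q * r ^ s))) + real (card ?N) * exp (- (real N * (c * r ^ s)))"
    by simp
  also have "\<dots> \<le> (1 / b) * exp (- (real N * (q * r ^ s)))
      + (real (card T) * (C * (2 * r) ^ s / b)) * exp (- (real N * (c * r ^ s)))"
  proof (intro add_mono mult_right_mono)
    have "card (F - ?N) \<le> card F" using F(1) by (intro card_mono) auto
    then show "real (card (F - ?N)) \<le> 1 / b" using card_F by linarith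
    have "real (card ?N) \<le> (\<Sum>t\<in>T. real (card (F \<inter> cball t r)))"
      using card_UN_le[OF T(1), of "\<lambda>t. F \<inter> cball t r"] by (metis of_nat_mono of_nat_sum)
    also have "\<dots> \<le> (\<Sum>t\<in>T. C * (2 * r) ^ s / b)" by (intro sum_mono card_T)
    finally show "real (card ?N) \<le> real (card T) * (C * (2 * r) ^ s / b)" by simp
  qed auto
  finally show ?thesis unfolding b_def by simp
qed

text \<open>
  If the ball of radius \<open>r\<close> around some point of \<open>K\<close> is missed, then the covering radius is at least
  \<open>r\<close>; disjointness of the balls brings in the second moment bound.
\<close>
lemma prob_\<rho>_ge:
  assumes F: "finite F" "F \<subseteq> K" "separated (2 * r) F" "F \<noteq> {}"
    and q: "\<And>z. z \<in> F \<Longrightarrow> measure \<mu> (cball z r) \<le> q" "q < 1"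
  shows "1 - 1 / (real (card F) * (1 - q) ^ N) \<le> prob {\<omega> \<in> space M. r \<le> \<rho> \<omega>}"
proof -
  interpret \<mu>: prob_space \<mu> by (rule prob_space_\<mu>)
  define m where "m = (\<Sum>z\<in>F. (1 - measure \<mu> (cball z r)) ^ N)"
  have "real (card F) * (1 - q) ^ N = (\<Sum>z\<in>F. (1 - q) ^ N)" by simp
  also have "\<dots> \<le> m"
    unfolding m_def using q by (intro sum_mono power_mono) auto
  finally have le: "real (card F) * (1 - q) ^ N \<le> m" .
  have pos: "0 < real (card F) * (1 - q) ^ N" using F q(2) by (simp add: card_gt_0_iff)
  have "1 - 1 / (real (card F) * (1 - q) ^ N) \<le> 1 - 1 / m"
    using frac_le[OF _ _ pos le, of 1 1] by simp
  also have "\<dots> \<le> prob (\<Union>z\<in>F. missed (cball z r))"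
    by (rule prob_some_missed_ge)
       (use F(1) m_def pos le separated_disjoint_cball[OF F(3)] in auto)
  also have "\<dots> \<le> prob {\<omega> \<in> space M. r \<le> \<rho> \<omega>}"
  proof (rule finite_measure_mono)
    show "(\<Union>z\<in>F. missed (cball z r)) \<subseteq> {\<omega> \<in> space M. r \<le> \<rho> \<omega>}"
    proof safe
      fix z \<omega> assume z: "z \<in> F" and \<omega>: "\<omega> \<in> missed (cball z r)"
      then show "\<omega> \<in> space M" by (simp add: missed_def)
      have "z \<in> K" using z F(2) by blast
      then obtain j where j: "j \<in> {1..N}" "dist z (X j \<omega>) \<le> \<rho> \<omega>"
        using \<rho>_le_iff[of \<omega> "\<rho> \<omega>"] by blast
      then have "X j \<omega> \<notin> cball z r" using \<omega> unfolding missed_def by blast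
      then show "r \<le> \<rho> \<omega>" using j(2) by simp
    qed
  qed measurable
  finally show ?thesis .
qed

lemma integrable_\<rho>_powr: "0 \<le> p \<Longrightarrow> integrable M (\<lambda>\<omega>. \<rho> \<omega> powr p)"
proof (rule integrable_const_bound[where B = "diameter K powr p"])
  assume p: "0 \<le> p"
  show "AE \<omega> in M. norm (\<rho> \<omega> powr p) \<le> diameter K powr p"
    using AE_\<rho>_le_diameter by eventually_elim (use p in \<open>auto intro: powr_mono2 \<rho>_nonneg\<close>)
qed measurable

text \<open>
  The two thresholds play different roles. Passing \<open>a\<close>, near the typical value of \<open>\<rho>\<close>, is unlikely,
  but its probability may decay too slowly to be multiplied with the diameter of \<open>K\<close>, which is of
  order \<open>1\<close>. The diameter is therefore used only past a large multiple \<open>b\<close> of the typical value,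
  where the probability decays as fast as desired.
\<close>
lemma expectation_\<rho>_le:
  assumes "0 \<le> p" "0 \<le> a" "0 \<le> b"
  shows "expectation (\<lambda>\<omega>. \<rho> \<omega> powr p) \<le> a powr p + b powr p * prob {\<omega> \<in> space M. a < \<rho> \<omega>}
           + diameter K powr p * prob {\<omega> \<in> space M. b < \<rho> \<omega>}"
proof -
  let ?A = "{\<omega> \<in> space M. a < \<rho> \<omega>}" and ?B = "{\<omega> \<in> space M. b < \<rho> \<omega>}"
  let ?g = "\<lambda>\<omega>. a powr p + b powr p * indicator ?A \<omega> + diameter K powr p * indicator ?B \<omega>"
  have i: "integrable M (\<lambda>\<omega>. indicator ?A \<omega> :: real)" "integrable M (\<lambda>\<omega>. indicator ?B \<omega> :: real)"
    by (auto intro!: integrable_real_indicator simp: emeasure_eq_measure)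
  have "expectation (\<lambda>\<omega>. \<rho> \<omega> powr p) \<le> expectation ?g"
  proof (rule integral_mono_AE)
    show "integrable M ?g" using i by simp
    show "AE \<omega> in M. \<rho> \<omega> powr p \<le> ?g \<omega>"
      using AE_\<rho>_le_diameter AE_space
    proof eventually_elim
      case (elim \<omega>)
      have nn: "0 \<le> a powr p" "0 \<le> b powr p * indicator ?A \<omega>" "0 \<le> diameter K powr p * indicator ?B \<omega>"
        by simp_all
      have mono: "\<rho> \<omega> powr p \<le> x powr p" if "\<rho> \<omega> \<le> x" for x
        using that assms \<rho>_nonneg by (intro powr_mono2) auto
      consider "\<rho> \<omega> \<le> a" | "a < \<rho> \<omega>" "\<rho> \<omega> \<le> b" | "b < \<rho> \<omega>" by linarith
      then show ?case
      proof cases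
        case 1
        then show ?thesis using mono[OF 1] nn by linarith
      next
        case 2
        then have "b powr p * indicator ?A \<omega> = b powr p" using elim by simp
        then show ?thesis using mono[OF 2(2)] nn by linarith
      next
        case 3
        then have "diameter K powr p * indicator ?B \<omega> = diameter K powr p" using elim by simp
        then show ?thesis using mono[of "diameter K"] elim nn by linarith
      qed
    qed
  qed (use integrable_\<rho>_powr assms in auto)
  also have "expectation ?g = a powr p + b powr p * prob ?A + diameter K powr p * prob ?B"
    using i by (simp add: prob_space)
  finally show ?thesis .
qed

lemma expectation_\<rho>_ge:
  assumes "0 \<le> p" "0 \<le> a"
  shows "a powr p * prob {\<omega> \<in> space M. a \<le> \<rho> \<omega>} \<le> expectation (\<lambda>\<omega>. \<rho> \<omega> powr p)"
proof -
  let ?A = "{\<omega> \<in> space M. a \<le> \<rho> \<omega>}"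
  have i: "integrable M (\<lambda>\<omega>. indicator ?A \<omega> :: real)"
    by (auto intro!: integrable_real_indicator simp: emeasure_eq_measure)
  have "a powr p * prob ?A = expectation (\<lambda>\<omega>. a powr p * indicator ?A \<omega>)" by simp
  also have "\<dots> \<le> expectation (\<lambda>\<omega>. \<rho> \<omega> powr p)"
    by (rule integral_mono)
       (use i integrable_\<rho>_powr assms in \<open>auto simp: indicator_def intro: powr_mono2\<close>)
  finally show ?thesis .
qed

end

section \<open>Growing samples\<close>

text \<open>
  The order of magnitude of the covering radius: a ball of this radius has mass comparable to
  \<open>ln N / N\<close>, and a set of mass \<open>\<gamma> * ln N / N\<close> is missed by \<open>N\<close> points with probability about
  \<open>N powr - \<gamma>\<close>, to be compared with about \<open>N / ln N\<close> disjoint balls.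
\<close>
definition scale :: "nat \<Rightarrow> nat \<Rightarrow> real" where
  "scale s N = (ln (real N) / real N) powr (1 / real s)"

lemma scale_pos: "2 \<le> N \<Longrightarrow> 0 < scale s N"
  by (simp add: scale_def)

lemma scale_power: "2 \<le> N \<Longrightarrow> 0 < s \<Longrightarrow> scale s N ^ s = ln (real N) / real N"
  using scale_pos[of N s] by (simp add: scale_def powr_realpow[symmetric] powr_powr)

lemma scale_tendsto_0: "0 < s \<Longrightarrow> scale s \<longlonglongrightarrow> 0"
  unfolding scale_def by real_asymp

lemma scale_powr_mult:
  assumes "2 \<le> N" "0 < s"
  shows "scale s N powr p * (real N / ln (real N)) powr (p / real s) = 1"
proof -
  have *: "0 < ln (real N) / real N" "0 < real N / ln (real N)" using assms by simp_all
  have "scale s N powr p = (ln (real N) / real N) powr (p / real s)"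
    unfolding scale_def powr_powr by simp
  also have "\<dots> * (real N / ln (real N)) powr (p / real s) = ((ln (real N) / real N) * (real N / ln (real N))) powr (p / real s)"
    using * by (subst powr_mult) auto
  also have "(ln (real N) / real N) * (real N / ln (real N)) = 1" using assms by simp
  finally show ?thesis by simp
qed

lemma exp_scale:
  assumes "2 \<le> N" "0 < s"
  shows "exp (- (real N * (q * (a * scale s N) ^ s))) = real N powr (- (q * a ^ s))"
  using assms by (simp add: power_mult_distrib scale_power powr_def)

text \<open>
  The metric properties of \<open>\<mu>\<close> from which the asymptotics follow: Ahlfors regularity with crude
  constants \<open>c\<close> and \<open>C\<close>, and density \<open>v\<close> in two one-sided senses. From below, all points have almost
  full density except those within the very same radius \<open>r\<close> of a finite set \<open>T\<close>; from above, it
  is enough that many disjoint balls do not carry too much mass.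
\<close>
locale random_cover_sequence =
  fixes M :: "nat \<Rightarrow> 'w measure" and X :: "nat \<Rightarrow> nat \<Rightarrow> 'w \<Rightarrow> real ^ 'd"
    and \<mu> :: "(real ^ 'd) measure" and K :: "(real ^ 'd) set" and s :: nat and c C r0 v :: real
  assumes cover: "\<And>N. 1 \<le> N \<Longrightarrow> random_cover (M N) (X N) N \<mu> K"
    and s: "0 < s" and c: "0 < c" and r0: "0 < r0" and v: "0 < v"
    and lower: "\<And>x r. x \<in> K \<Longrightarrow> 0 < r \<Longrightarrow> r < r0 \<Longrightarrow> c * r ^ s \<le> measure \<mu> (cball x r)"
    and upper: "\<And>x r. x \<in> K \<Longrightarrow> 0 < r \<Longrightarrow> r < r0 \<Longrightarrow> measure \<mu> (cball x r) \<le> C * r ^ s"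
    and lower_density: "\<And>\<epsilon>. 0 < \<epsilon> \<Longrightarrow> \<exists>r1>0. \<exists>T. finite T \<and> T \<subseteq> K \<and>
       (\<forall>r y. 0 < r \<and> r < r1 \<and> y \<in> K - (\<Union>t\<in>T. cball t r) \<longrightarrow> (1 - \<epsilon>) * v * r ^ s \<le> measure \<mu> (cball y r))"
    and upper_density: "\<And>\<epsilon>. 0 < \<epsilon> \<Longrightarrow> \<exists>\<kappa>>0. \<exists>r1>0. \<forall>r. 0 < r \<and> r < r1 \<longrightarrow>
       (\<exists>F. finite F \<and> F \<subseteq> K \<and> separated (2 * r) F \<and> \<kappa> \<le> real (card F) * r ^ s \<and>
            (\<forall>y\<in>F. measure \<mu> (cball y r) \<le> (1 + \<epsilon>) * v * r ^ s))"
begin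

definition \<rho> :: "nat \<Rightarrow> 'w \<Rightarrow> real" where
  "\<rho> N \<omega> = covering_radius ((\<lambda>j. X N j \<omega>) ` {1..N}) K"

lemma \<rho>_eq: "1 \<le> N \<Longrightarrow> random_cover.\<rho> (X N) N K = \<rho> N"
  using random_cover.\<rho>_def[OF cover] by (auto simp: \<rho>_def fun_eq_iff)

lemma eventually_scale_less:
  assumes "0 < d"
  shows "\<forall>\<^sub>F N in sequentially. 2 \<le> N \<and> a * scale s N < d"
proof (intro eventually_conj eventually_ge_at_top)
  have "(\<lambda>N. a * scale s N) \<longlonglongrightarrow> a * 0" by (intro tendsto_intros scale_tendsto_0 s)
  then show "\<forall>\<^sub>F N in sequentially. a * scale s N < d" using assms by (intro order_tendstoD) auto
qed

definition tail :: "real \<Rightarrow> nat \<Rightarrow> real" where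
  "tail a N = measure (M N) {\<omega> \<in> space (M N). a * scale s N < \<rho> N \<omega>}"

lemma tail_nonneg: "0 \<le> tail a N" by (simp add: tail_def)

text \<open>
  The union bound for a net of mesh \<open>\<eta> * scale s N\<close> and balls of radius \<open>a * scale s N\<close>. In the number of
  net points near \<open>T\<close> the powers of the scale cancel, which is why the second summand has no factor
  \<open>N / ln N\<close>.
\<close>
lemma tail_le:
  assumes T: "finite T" "T \<subseteq> K" "0 < r1"
      "\<And>r y. 0 < r \<Longrightarrow> r < r1 \<Longrightarrow> y \<in> K - (\<Union>t\<in>T. cball t r) \<Longrightarrow> q * r ^ s \<le> measure \<mu> (cball y r)"
    and \<eta>: "0 < \<eta>" "\<eta> \<le> a"
  obtains A B where "0 \<le> A" "0 \<le> B"
    "\<forall>\<^sub>F N in sequentially. tail (a + \<eta>) N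
       \<le> A * (real N / ln (real N) * real N powr (- (q * a ^ s)))
         + real (card T) * B * real N powr (- (c * a ^ s))"
proof
  define B where "B = \<bar>C\<bar> * (2 * a) ^ s / (c * (\<eta> / 2) ^ s)"
  show "0 \<le> 1 / (c * (\<eta> / 2) ^ s)" using c \<eta> by simp
  show "0 \<le> B" using c \<eta> by (simp add: B_def)
  show "\<forall>\<^sub>F N in sequentially. tail (a + \<eta>) N
       \<le> 1 / (c * (\<eta> / 2) ^ s) * (real N / ln (real N) * real N powr (- (q * a ^ s)))
         + real (card T) * B * real N powr (- (c * a ^ s))"
    using eventually_scale_less[OF r0, of "2 * a"] eventually_scale_less[OF T(3), of a]
  proof eventually_elim
    case (elim N)
    then have N: "2 \<le> N" by simp
    interpret N: random_cover "M N" "X N" N \<mu> K using N by (intro cover) auto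
    let ?\<sigma> = "scale s N"
    have \<sigma>: "0 < ?\<sigma>" by (rule scale_pos[OF N])
    have "tail (a + \<eta>) N = N.prob {\<omega> \<in> space (M N). \<eta> * ?\<sigma> + a * ?\<sigma> < N.\<rho> \<omega>}"
      unfolding tail_def using \<rho>_eq[of N] N by (simp add: algebra_simps)
    also have "\<dots> \<le> exp (- (real N * (q * (a * ?\<sigma>) ^ s))) / (c * (\<eta> * ?\<sigma> / 2) ^ s)
        + real (card T) * (C * (2 * (a * ?\<sigma>)) ^ s / (c * (\<eta> * ?\<sigma> / 2) ^ s)) * exp (- (real N * (c * (a * ?\<sigma>) ^ s)))"
    proof (rule N.prob_\<rho>_gt_le[OF c])
      show "q * (a * ?\<sigma>) ^ s \<le> measure \<mu> (cball y (a * ?\<sigma>))" if "y \<in> K - (\<Union>t\<in>T. cball t (a * ?\<sigma>))" for y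
        using that elim \<eta> \<sigma> by (intro T(4)) auto
    qed (use lower upper T elim \<eta> \<sigma> in \<open>auto simp: mult.assoc\<close>)
    also have "C * (2 * (a * ?\<sigma>)) ^ s / (c * (\<eta> * ?\<sigma> / 2) ^ s) = C * (2 * a) ^ s / (c * (\<eta> / 2) ^ s)"
      using \<sigma> by (simp add: power_mult_distrib power_divide)
    also have "c * (\<eta> * ?\<sigma> / 2) ^ s = c * (\<eta> / 2) ^ s * (ln (real N) / real N)"
      using scale_power[OF N s] by (simp add: power_mult_distrib power_divide mult_ac)
    also have "real (card T) * (C * (2 * a) ^ s / (c * (\<eta> / 2) ^ s)) * exp (- (real N * (c * (a * ?\<sigma>) ^ s)))
       \<le> real (card T) * B * exp (- (real N * (c * (a * ?\<sigma>) ^ s)))"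
      unfolding B_def using c \<eta> by (intro mult_right_mono mult_left_mono divide_right_mono) auto
    finally show ?case unfolding exp_scale[OF N s] by (simp add: mult_ac)
  qed
qed

text \<open>
  The exponent \<open>v * b ^ s > 1\<close> leaves room to lower \<open>b\<close> and \<open>v\<close> by a factor \<open>1 - t\<close>. The difference
  \<open>b * t\<close> becomes the mesh of the net.
\<close>
lemma tail_tendsto_0:
  assumes "1 < v * b ^ s" "0 < b"
  shows "tail b \<longlonglongrightarrow> 0"
proof -
  have "((\<lambda>t. (1 - t) * v * (b * (1 - t)) ^ s) \<longlongrightarrow> (1 - 0) * v * (b * (1 - 0)) ^ s) (at_right 0)"
    by (intro tendsto_intros)
  then have "\<forall>\<^sub>F t in at_right 0. 1 < (1 - t) * v * (b * (1 - t)) ^ s"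
    using assms by (intro order_tendstoD) auto
  moreover have "\<forall>\<^sub>F t in at_right (0::real). t \<in> {0<..<1 / 2}"
    by (rule eventually_at_right_real) simp
  ultimately have "\<forall>\<^sub>F t in at_right 0. 1 < (1 - t) * v * (b * (1 - t)) ^ s \<and> t < 1 / 2 \<and> 0 < t"
    by eventually_elim auto
  then obtain t where t: "1 < (1 - t) * v * (b * (1 - t)) ^ s" "t < 1 / 2" "0 < t"
    using eventually_happens'[OF trivial_limit_at_right_real] by blast
  define a where "a = b * (1 - t)"
  obtain r1 T where T: "0 < r1" "finite T" "T \<subseteq> K"
     "\<forall>r y. 0 < r \<and> r < r1 \<and> y \<in> K - (\<Union>t\<in>T. cball t r) \<longrightarrow> (1 - t) * v * r ^ s \<le> measure \<mu> (cball y r)"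
    using lower_density[OF t(3)] by (elim exE conjE)
  note T4 = T(4)[rule_format, OF conjI[OF _ conjI]]
  have \<eta>: "0 < b * t" "b * t \<le> a" using assms t by (auto simp: a_def)
  obtain A B where AB: "0 \<le> A" "0 \<le> B"
    "\<forall>\<^sub>F N in sequentially. tail (a + b * t) N
       \<le> A * (real N / ln (real N) * real N powr (- ((1 - t) * v * a ^ s)))
         + real (card T) * B * real N powr (- (c * a ^ s))"
    by (rule tail_le[OF T(2,3,1) T4 \<eta>])
  have "(1 - t) * v * a ^ s > 1" using t by (simp add: a_def)
  then have 1: "(\<lambda>N. real N / ln (real N) * real N powr (- ((1 - t) * v * a ^ s))) \<longlonglongrightarrow> 0"
    by real_asymp
  have "0 < c * a ^ s" using c \<eta> by simp
  then have 2: "(\<lambda>N. real N powr (- (c * a ^ s))) \<longlonglongrightarrow> 0" by real_asymp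
  have "(\<lambda>N. A * (real N / ln (real N) * real N powr (- ((1 - t) * v * a ^ s)))
         + real (card T) * B * real N powr (- (c * a ^ s))) \<longlonglongrightarrow> A * 0 + real (card T) * B * 0"
    by (intro tendsto_intros 1 2)
  then have "tail (a + b * t) \<longlonglongrightarrow> 0"
    by (intro tendsto_sandwich[OF always_eventually AB(3) tendsto_const]) (simp_all add: tail_nonneg)
  then show ?thesis by (simp add: a_def algebra_simps)
qed

text \<open>
  With the exceptional set empty and \<open>c\<close> in place of the sharp density, any polynomial rate is reached
  by a sufficiently large multiple of the scale: the exponent \<open>c * a ^ s\<close> is chosen as \<open>\<bar>t\<bar> + 2\<close>,
  of which \<open>1\<close> pays for the cardinality of the net and \<open>t\<close> for the factor to be absorbed.
\<close>
lemma exists_small_tail: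
  obtains b where "0 < b" "(\<lambda>N. tail b N * (real N / ln (real N)) powr t) \<longlonglongrightarrow> 0"
proof -
  define a where "a = ((\<bar>t\<bar> + 2) / c) powr (1 / real s)"
  have a: "0 < a" "c * a ^ s = \<bar>t\<bar> + 2" using c s
    by (auto simp: a_def powr_realpow[symmetric] powr_powr)
  obtain A B where AB: "0 \<le> A" "0 \<le> B"
    "\<forall>\<^sub>F N in sequentially. tail (a + a) N
       \<le> A * (real N / ln (real N) * real N powr (- (c * a ^ s)))
         + real (card ({} :: (real ^ 'd) set)) * B * real N powr (- (c * a ^ s))"
    by (rule tail_le[of "{}" r0 c a a]) (use lower r0 a(1) in auto)
  have "\<bar>t\<bar> + 2 > t + 1" by simp
  then have 1: "(\<lambda>N. real N / ln (real N) * real N powr (- (\<bar>t\<bar> + 2)) * (real N / ln (real N)) powr t) \<longlonglongrightarrow> 0"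
    by real_asymp
  have 2: "(\<lambda>N. A * (real N / ln (real N) * real N powr (- (\<bar>t\<bar> + 2)) * (real N / ln (real N)) powr t)) \<longlonglongrightarrow> A * 0"
    by (intro tendsto_intros 1)
  have "(\<lambda>N. tail (a + a) N * (real N / ln (real N)) powr t) \<longlonglongrightarrow> 0"
  proof (rule tendsto_sandwich[OF _ _ tendsto_const])
    show "(\<lambda>N. A * (real N / ln (real N) * real N powr (- (\<bar>t\<bar> + 2)) * (real N / ln (real N)) powr t)) \<longlonglongrightarrow> 0"
      using 2 by simp
    show "\<forall>\<^sub>F N in sequentially. tail (a + a) N * (real N / ln (real N)) powr t
        \<le> A * (real N / ln (real N) * real N powr (- (\<bar>t\<bar> + 2)) * (real N / ln (real N)) powr t)"
      using AB(3)
    proof eventually_elim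
      case (elim N)
      then have "tail (a + a) N * (real N / ln (real N)) powr t
         \<le> A * (real N / ln (real N) * real N powr (- (\<bar>t\<bar> + 2))) * (real N / ln (real N)) powr t"
        unfolding a(2) by (intro mult_right_mono) auto
      then show ?case by (simp only: mult.assoc)
    qed
  qed (simp add: tail_nonneg)
  then show ?thesis using that[of "a + a"] a(1) by simp
qed

text \<open>
  The expected number of missed balls is at least of order \<open>N / ln N * N powr - g\<close> with
  \<open>g = (1 + \<epsilon>) * v * b ^ s\<close>, which tends to infinity as long as \<open>g < 1\<close>.
\<close>
lemma prob_\<rho>_ge_tendsto_1:
  assumes b: "0 < b" "v * b ^ s < 1"
  shows "(\<lambda>N. measure (M N) {\<omega> \<in> space (M N). b * scale s N \<le> \<rho> N \<omega>}) \<longlonglongrightarrow> 1"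
proof -
  define \<epsilon> where "\<epsilon> = (1 / (v * b ^ s) - 1) / 2"
  have vb: "0 < v * b ^ s" using v b by simp
  define g where "g = (1 + \<epsilon>) * v * b ^ s"
  have \<epsilon>: "0 < \<epsilon>" using b vb by (simp add: \<epsilon>_def field_simps)
  \<comment> \<open>Half of the slack in \<open>v * b ^ s < 1\<close> is spent on \<open>\<epsilon>\<close>, so \<open>g\<close> is the midpoint of \<open>v * b ^ s\<close> and \<open>1\<close>.\<close>
  have g_eq: "g = (v * b ^ s + 1) / 2"
  proof -
    have "(1 + (1 / x - 1) / 2) * x = (x + 1) / 2" if "0 < x" for x :: real
      using that by (simp add: field_simps)
    from this[OF vb] show ?thesis by (simp only: g_def \<epsilon>_def mult.assoc)
  qed
  have g: "0 < g" "g < 1" using vb b unfolding g_eq by auto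
  obtain \<kappa> r1 where \<kappa>: "0 < \<kappa>" "0 < r1" and F: "\<forall>r. 0 < r \<and> r < r1 \<longrightarrow>
       (\<exists>F. finite F \<and> F \<subseteq> K \<and> separated (2 * r) F \<and> \<kappa> \<le> real (card F) * r ^ s \<and>
            (\<forall>y\<in>F. measure \<mu> (cball y r) \<le> (1 + \<epsilon>) * v * r ^ s))"
    using upper_density[OF \<epsilon>] by (elim exE conjE)
  let ?m = "\<lambda>N. real N / ln (real N) * (1 - g * (ln (real N) / real N)) ^ N"
  have m: "filterlim ?m at_top sequentially" using g by real_asymp
  then have "filterlim (\<lambda>N. \<kappa> / b ^ s * ?m N) at_top sequentially"
    by (rule filterlim_tendsto_pos_mult_at_top[OF tendsto_const, rotated]) (use \<kappa> b in simp)
  then have "(\<lambda>N. 1 - 1 / (\<kappa> / b ^ s * ?m N)) \<longlonglongrightarrow> 1 - 0"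
    by (intro tendsto_diff tendsto_const real_tendsto_divide_at_top[OF tendsto_const])
  then have lim: "(\<lambda>N. 1 - 1 / (\<kappa> / b ^ s * ?m N)) \<longlonglongrightarrow> 1"
    by (simp only: diff_zero)
  have ge: "\<forall>\<^sub>F N in sequentially. 1 - 1 / (\<kappa> / b ^ s * ?m N)
      \<le> measure (M N) {\<omega> \<in> space (M N). b * scale s N \<le> \<rho> N \<omega>}"
  proof -
    have "(\<lambda>N. g * (ln (real N) / real N)) \<longlonglongrightarrow> 0" by real_asymp
    then have "\<forall>\<^sub>F N in sequentially. g * (ln (real N) / real N) < 1"
      by (rule order_tendstoD) simp
    then show ?thesis
      using eventually_scale_less[OF \<kappa>(2), of b]
    proof eventually_elim
      case (elim N)
      then have N: "2 \<le> N" by simp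
      interpret N: random_cover "M N" "X N" N \<mu> K using N by (intro cover) auto
      let ?r = "b * scale s N"
      let ?q = "g * (ln (real N) / real N)"
      have r: "0 < ?r" using scale_pos[OF N] b by simp
      have rs: "?r ^ s = b ^ s * (ln (real N) / real N)" using scale_power[OF N s] by (simp add: power_mult_distrib)
      obtain F where F: "finite F" "F \<subseteq> K" "separated (2 * ?r) F" "\<kappa> \<le> real (card F) * ?r ^ s"
          "\<And>y. y \<in> F \<Longrightarrow> measure \<mu> (cball y ?r) \<le> (1 + \<epsilon>) * v * ?r ^ s"
        using F[rule_format, of ?r] r elim by auto
      have ne: "F \<noteq> {}" using F(4) \<kappa>(1) by auto
      have q: "(1 + \<epsilon>) * v * ?r ^ s = ?q" by (simp add: rs g_def)
      have lN: "0 < ln (real N)" using N by simp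
      have "\<kappa> \<le> real (card F) * b ^ s * (ln (real N) / real N)" using F(4) unfolding rs by (simp add: mult.assoc)
      then have "\<kappa> / b ^ s * (real N / ln (real N)) \<le> real (card F)"
        using b lN N by (simp add: field_simps)
      then have le: "\<kappa> / b ^ s * ?m N \<le> real (card F) * (1 - ?q) ^ N"
        unfolding mult.assoc[symmetric] using elim by (intro mult_right_mono) auto
      have "0 < \<kappa> / b ^ s * ?m N" using \<kappa> b elim N lN by simp
      then have "1 - 1 / (\<kappa> / b ^ s * ?m N) \<le> 1 - 1 / (real (card F) * (1 - ?q) ^ N)"
        using frac_le[OF _ _ _ le, of 1 1] by simp
      also have "\<dots> \<le> N.prob {\<omega> \<in> space (M N). ?r \<le> N.\<rho> \<omega>}"
        using F ne q elim by (intro N.prob_\<rho>_ge) auto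
      finally show ?case using \<rho>_eq[of N] N by simp
    qed
  qed
  have le_1: "\<forall>\<^sub>F N in sequentially. measure (M N) {\<omega> \<in> space (M N). b * scale s N \<le> \<rho> N \<omega>} \<le> 1"
    using eventually_ge_at_top[of 1]
  proof eventually_elim
    case (elim N)
    interpret N: random_cover "M N" "X N" N \<mu> K using elim by (rule cover)
    show ?case by simp
  qed
  show ?thesis by (rule tendsto_sandwich[OF ge le_1 lim tendsto_const])
qed

text \<open>
  Rescaled by \<open>scale s N\<close>, the covering radius concentrates at \<open>w = (1 / v) powr (1 / s)\<close>, the radius
  for which \<open>v * w ^ s = 1\<close>. The tail estimates turn this into convergence of moments.
\<close>
theorem expectation_asymptotics:
  assumes p: "0 < p"
  shows "(\<lambda>N. prob_space.expectation (M N) (\<lambda>\<omega>. \<rho> N \<omega> powr p) * (real N / ln (real N)) powr (p / real s))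
           \<longlonglongrightarrow> (1 / v) powr (p / real s)"
    (is "?E \<longlonglongrightarrow> ?L")
proof -
  define w where "w = (1 / v) powr (1 / real s)"
  have w: "0 < w" using v by (simp add: w_def)
  have L: "?L = w powr p" by (simp add: w_def powr_powr)
  have wb: "v * x ^ s = (x / w) ^ s" if "0 < x" for x
    using v s by (simp add: w_def power_divide powr_realpow[symmetric] powr_powr)
  show ?thesis
  proof (rule order_tendstoI)
    fix y assume y: "?L < y"
    define y' where "y' = (?L + y) / 2"
    have L0: "0 < ?L" using v by simp
    have y': "?L < y'" "y' < y" using y by (simp_all add: y'_def)
    have y'0: "0 < y'" using L0 y'(1) by (rule less_trans)
    define a where "a = y' powr (1 / p)"
    have ap: "a powr p = y'" using y'0 p by (simp add: a_def powr_powr)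
    have a: "w < a"
    proof (rule ccontr)
      assume "\<not> w < a"
      then have "a powr p \<le> w powr p" using p by (intro powr_mono2) (auto simp: a_def)
      then show False using y' L ap by simp
    qed
    have "1 < v * a ^ s" unfolding wb[OF less_trans[OF w a]] using w a s by (intro one_less_power) auto
    then have t0: "tail a \<longlonglongrightarrow> 0" using a w by (intro tail_tendsto_0) auto
    obtain b where b: "0 < b" "(\<lambda>N. tail b N * (real N / ln (real N)) powr (p / real s)) \<longlonglongrightarrow> 0"
      by (rule exists_small_tail)
    let ?U = "\<lambda>N. a powr p + b powr p * tail a N + diameter K powr p * (tail b N * (real N / ln (real N)) powr (p / real s))"
    have "?U \<longlonglongrightarrow> a powr p + b powr p * 0 + diameter K powr p * 0"
      by (intro tendsto_intros t0 b(2))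
    then have "\<forall>\<^sub>F N in sequentially. ?U N < y" using y' ap by (intro order_tendstoD) auto
    then show "\<forall>\<^sub>F N in sequentially. ?E N < y"
      using eventually_ge_at_top[of 2]
    proof eventually_elim
      case (elim N)
      interpret N: random_cover "M N" "X N" N \<mu> K using elim by (intro cover) auto
      have \<sigma>: "0 < scale s N" using elim by (intro scale_pos)
      note sc = scale_powr_mult[OF elim(2) s, of p]
      let ?t = "(real N / ln (real N)) powr (p / real s)"
      have "N.expectation (\<lambda>\<omega>. \<rho> N \<omega> powr p) \<le> (a * scale s N) powr p + (b * scale s N) powr p * tail a N
           + diameter K powr p * tail b N"
        unfolding tail_def using N.expectation_\<rho>_le[of p "a * scale s N" "b * scale s N"] \<rho>_eq[of N] elim a w b \<sigma> p
        by simp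
      then have "?E N \<le> ((a * scale s N) powr p + (b * scale s N) powr p * tail a N + diameter K powr p * tail b N) * ?t"
        by (rule mult_right_mono) simp
      also have "\<dots> = a powr p * (scale s N powr p * ?t) + b powr p * tail a N * (scale s N powr p * ?t)
          + diameter K powr p * (tail b N * ?t)"
        using a w b \<sigma> by (simp add: powr_mult algebra_simps)
      also have "\<dots> = ?U N" unfolding sc by simp
      finally show ?case using elim by simp
    qed
  next
    fix y assume y: "y < ?L"
    have "max y 0 < ?L" using y v by simp
    then obtain y' where "max y 0 < y'" "y' < ?L" using dense by blast
    then have y': "y < y'" "y' < ?L" "0 < y'" by simp_all
    define a where "a = y' powr (1 / p)"
    have ap: "a powr p = y'" using y' p by (simp add: a_def powr_powr)
    have a0: "0 < a" using y' by (simp add: a_def)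
    have a: "a < w"
    proof (rule ccontr)
      assume "\<not> a < w"
      then have "w powr p \<le> a powr p" using p w by (intro powr_mono2) auto
      then show False using y' L ap by simp
    qed
    have "v * a ^ s < 1" unfolding wb[OF a0] using w a a0 s by (intro power_less_one_iff[THEN iffD2]) auto
    note t1 = prob_\<rho>_ge_tendsto_1[OF a0 this]
    have "(\<lambda>N. a powr p * measure (M N) {\<omega> \<in> space (M N). a * scale s N \<le> \<rho> N \<omega>}) \<longlonglongrightarrow> a powr p * 1"
      by (intro tendsto_intros t1)
    then have "\<forall>\<^sub>F N in sequentially. y < a powr p * measure (M N) {\<omega> \<in> space (M N). a * scale s N \<le> \<rho> N \<omega>}"
      using y' ap by (intro order_tendstoD) auto
    then show "\<forall>\<^sub>F N in sequentially. y < ?E N"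
      using eventually_ge_at_top[of 2]
    proof eventually_elim
      case (elim N)
      interpret N: random_cover "M N" "X N" N \<mu> K using elim by (intro cover) auto
      have \<sigma>: "0 < scale s N" using elim by (intro scale_pos)
      note sc = scale_powr_mult[OF elim(2) s, of p]
      let ?t = "(real N / ln (real N)) powr (p / real s)"
      let ?P = "N.prob {\<omega> \<in> space (M N). a * scale s N \<le> \<rho> N \<omega>}"
      have "a powr p * ?P = a powr p * ?P * (scale s N powr p * ?t)" unfolding sc by simp
      also have "\<dots> = (a * scale s N) powr p * ?P * ?t" using a0 \<sigma> by (simp add: powr_mult)
      also have "\<dots> \<le> ?E N"
        using N.expectation_\<rho>_ge[of p "a * scale s N"] \<rho>_eq[of N] elim a0 \<sigma> p
        by (intro mult_right_mono) auto
      finally show ?case using elim by simp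
    qed
  qed
qed
end

section \<open>Regular sets\<close>

lemma hausdorff_mono: "A \<subseteq> B \<Longrightarrow> hausdorff S A \<le> hausdorff S B"
  unfolding hausdorff_def by (intro divide_right_mono_ennreal unnormalized_hausdorff_mono)

lemma sets_hausdorff_measure: "sets (hausdorff_measure S) = sets borel"
  unfolding hausdorff_measure_def using sets.sigma_sets_eq[of borel] by (simp add: sets_measure_of_conv)

text \<open>
  \<open>measure_of\<close> returns the zero measure when the given set function is not countably additive, and
  normalizing on a set of measure \<open>0\<close> or \<open>\<infinity>\<close> yields the zero measure as well. So if the uniform
  law on \<open>K\<close> is a probability measure at all, then \<open>hausdorff S\<close> is a measure on the Borel sets, and
  \<open>K\<close> has positive finite measure.
\<close>
lemma uniform_law_imp_hausdorff_measure:
  fixes K A :: "'a::metric_space set"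
  assumes "prob_space (uniform_measure (hausdorff_measure S) K)" and K: "K \<in> sets borel"
  shows "0 < hausdorff S K" "hausdorff S K < \<infinity>"
    and "A \<in> sets borel \<Longrightarrow> emeasure (hausdorff_measure S) A = hausdorff S A"
proof -
  let ?H = "hausdorff_measure S" and ?\<mu> = "uniform_measure (hausdorff_measure S) K"
  interpret prob_space ?\<mu> by fact
  have sp: "space ?\<mu> = UNIV" using sets_eq_imp_space_eq[OF sets_hausdorff_measure] by simp
  have "1 = emeasure ?H (K \<inter> UNIV) / emeasure ?H K"
    using emeasure_space_1 unfolding sp
    by (subst (asm) emeasure_uniform_measure) (use K in \<open>auto simp: sets_hausdorff_measure\<close>)
  then have ne: "emeasure ?H K \<noteq> 0" "emeasure ?H K \<noteq> top"
    by (auto simp: ennreal_divide_eq_top_iff)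
  have "measure_space UNIV (sigma_sets UNIV (sets borel)) (hausdorff S :: 'a set \<Rightarrow> ennreal)"
    using ne(1) unfolding hausdorff_measure_def emeasure_measure_of_conv by (auto split: if_splits)
  then have *: "emeasure ?H B = hausdorff S B" if "B \<in> sets borel" for B :: "'a set"
    unfolding hausdorff_measure_def emeasure_measure_of_conv using that by (auto intro: sigma_sets.Basic)
  then show "A \<in> sets borel \<Longrightarrow> emeasure ?H A = hausdorff S A" .
  show "0 < hausdorff S K" "hausdorff S K < \<infinity>"
    using ne *[OF K] by (auto simp: less_top zero_less_iff_neq_zero)
qed

text \<open>
  The common content of the two regularity notions. In the asymptotically flat case the exceptional
  set is empty.
\<close>
lemma regular_ball_bounds:
  fixes K :: "(real ^ 'd) set"
  assumes reg: "asymptotically_flat_regular TYPE('s::finite) K \<or> quasi_nice_regular TYPE('s) K"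
    and fin: "hausdorff TYPE('s) K < \<infinity>"
  defines "m \<equiv> \<lambda>x r. enn2real (hausdorff TYPE('s) (cball x r \<inter> K))"
    and "v \<equiv> unit_ball_vol (real CARD('s))" and "n \<equiv> CARD('s)"
  shows "\<exists>c C r0. 0 < c \<and> 0 < C \<and> 0 < r0 \<and>
           (\<forall>x\<in>K. \<forall>r. 0 < r \<and> r < r0 \<longrightarrow> c * r ^ n \<le> m x r \<and> m x r \<le> C * r ^ n)"
    and "0 < \<epsilon> \<Longrightarrow> \<exists>r1>0. \<exists>T. finite T \<and> T \<subseteq> K \<and>
           (\<forall>r y. 0 < r \<and> r < r1 \<and> y \<in> K - (\<Union>t\<in>T. cball t r) \<longrightarrow> (1 - \<epsilon>) * v * r ^ n \<le> m y r)"
proof -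
  have v: "0 < v" unfolding v_def by (rule unit_ball_vol_pos) simp
  have "(\<exists>c C r0. 0 < c \<and> 0 < C \<and> 0 < r0 \<and>
           (\<forall>x\<in>K. \<forall>r. 0 < r \<and> r < r0 \<longrightarrow> c * r ^ n \<le> m x r \<and> m x r \<le> C * r ^ n)) \<and>
      (0 < \<epsilon> \<longrightarrow> (\<exists>r1>0. \<exists>T. finite T \<and> T \<subseteq> K \<and>
           (\<forall>r y. 0 < r \<and> r < r1 \<and> y \<in> K - (\<Union>t\<in>T. cball t r) \<longrightarrow> (1 - \<epsilon>) * v * r ^ n \<le> m y r)))"
    using reg
  proof
    assume "asymptotically_flat_regular TYPE('s) K"
    then have lim: "uniform_limit K (\<lambda>r x. m x r / r ^ n) (\<lambda>x. v) (at_right 0)"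
      by (simp add: asymptotically_flat_regular_def m_def v_def n_def)
    have near: "\<exists>b>0. \<forall>r x. 0 < r \<and> r < b \<and> x \<in> K \<longrightarrow> (v - e) * r ^ n \<le> m x r \<and> m x r \<le> (v + e) * r ^ n"
      if e: "0 < e" for e
    proof -
      obtain b where b: "0 < b" "\<And>r x. 0 < r \<Longrightarrow> r < b \<Longrightarrow> x \<in> K \<Longrightarrow> dist (m x r / r ^ n) v < e"
        using uniform_limitD[OF lim e] unfolding eventually_at_right_field by blast
      have "(v - e) * r ^ n \<le> m x r \<and> m x r \<le> (v + e) * r ^ n" if "0 < r" "r < b" "x \<in> K" for r x
      proof -
        have "v - e \<le> m x r / r ^ n" "m x r / r ^ n \<le> v + e"
          using b(2)[OF that] by (auto simp: dist_real_def abs_less_iff)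
        then show ?thesis using that(1) by (simp add: field_simps)
      qed
      then show ?thesis using b(1) by blast
    qed
    show ?thesis
    proof (intro conjI impI)
      obtain b where "0 < b" "\<forall>r x. 0 < r \<and> r < b \<and> x \<in> K \<longrightarrow> (v - v/2) * r ^ n \<le> m x r \<and> m x r \<le> (v + v/2) * r ^ n"
        using near[of "v/2"] v by auto
      then show "\<exists>c C r0. 0 < c \<and> 0 < C \<and> 0 < r0 \<and>
           (\<forall>x\<in>K. \<forall>r. 0 < r \<and> r < r0 \<longrightarrow> c * r ^ n \<le> m x r \<and> m x r \<le> C * r ^ n)"
        using v by (intro exI[of _ "v - v/2"] exI[of _ "v + v/2"] exI[of _ b]) auto
      assume "0 < \<epsilon>"
      then obtain b where b: "0 < b" "\<forall>r x. 0 < r \<and> r < b \<and> x \<in> K \<longrightarrow> (v - \<epsilon> * v) * r ^ n \<le> m x r \<and> m x r \<le> (v + \<epsilon> * v) * r ^ n"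
        using near[of "\<epsilon> * v"] v by auto
      have "(1 - \<epsilon>) * v = v - \<epsilon> * v" by (simp add: algebra_simps)
      then show "\<exists>r1>0. \<exists>T. finite T \<and> T \<subseteq> K \<and>
           (\<forall>r y. 0 < r \<and> r < r1 \<and> y \<in> K - (\<Union>t\<in>T. cball t r) \<longrightarrow> (1 - \<epsilon>) * v * r ^ n \<le> m y r)"
        using b by (intro exI[of _ b] conjI exI[of _ "{}"]) auto
    qed
  next
    assume "quasi_nice_regular TYPE('s) K"
    then obtain c C r0 T where c: "0 < c" "0 < C" "0 < r0"
      and b: "\<forall>x\<in>K. \<forall>r. 0 < r \<and> r < r0 \<longrightarrow>
           ennreal (c * r ^ n) \<le> hausdorff TYPE('s) (cball x r \<inter> K) \<and>
           hausdorff TYPE('s) (cball x r \<inter> K) \<le> ennreal (C * r ^ n)"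
      and T: "finite T" "T \<subseteq> K" "\<forall>r. 0 < r \<and> r < r0 \<longrightarrow> (\<forall>y \<in> K - (\<Union>t\<in>T. cball t r).
                 ennreal (v * r ^ n) \<le> hausdorff TYPE('s) (cball y r \<inter> K))"
      unfolding quasi_nice_regular_def n_def v_def by blast
    have le_m: "a \<le> m x r" if "ennreal a \<le> hausdorff TYPE('s) (cball x r \<inter> K)" for a x r
    proof -
      have "hausdorff TYPE('s) (cball x r \<inter> K) < top"
        using hausdorff_mono[of "cball x r \<inter> K" K] fin by (auto intro: order_le_less_trans)
      then have "ennreal a \<le> ennreal (m x r)" using that by (simp add: m_def)
      then show ?thesis by (subst (asm) ennreal_le_iff) (simp_all add: m_def)
    qed
    have m_le: "m x r \<le> a" if "hausdorff TYPE('s) (cball x r \<inter> K) \<le> ennreal a" "0 \<le> a" for a x r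
      unfolding m_def using that by (rule enn2real_leI[rotated])
    show ?thesis
    proof (intro conjI impI)
      show "\<exists>c C r0. 0 < c \<and> 0 < C \<and> 0 < r0 \<and>
           (\<forall>x\<in>K. \<forall>r. 0 < r \<and> r < r0 \<longrightarrow> c * r ^ n \<le> m x r \<and> m x r \<le> C * r ^ n)"
        using c b by (intro exI[of _ c] exI[of _ C] exI[of _ r0]) (auto intro!: le_m m_le)
      assume "0 < \<epsilon>"
      have "(1 - \<epsilon>) * v * r ^ n \<le> m y r" if "0 < r \<and> r < r0 \<and> y \<in> K - (\<Union>t\<in>T. cball t r)" for r y
      proof -
        have "(1 - \<epsilon>) * v * r ^ n \<le> 1 * v * r ^ n"
          using \<open>0 < \<epsilon>\<close> v that by (intro mult_right_mono) auto
        also have "\<dots> \<le> m y r" using T(3) that by (intro le_m) simp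
        finally show ?thesis .
      qed
      then show "\<exists>r1>0. \<exists>T. finite T \<and> T \<subseteq> K \<and>
           (\<forall>r y. 0 < r \<and> r < r1 \<and> y \<in> K - (\<Union>t\<in>T. cball t r) \<longrightarrow> (1 - \<epsilon>) * v * r ^ n \<le> m y r)"
        using c T(1,2) by (intro exI[of _ r0] conjI exI[of _ T]) auto
    qed
  qed
  then show "\<exists>c C r0. 0 < c \<and> 0 < C \<and> 0 < r0 \<and>
           (\<forall>x\<in>K. \<forall>r. 0 < r \<and> r < r0 \<longrightarrow> c * r ^ n \<le> m x r \<and> m x r \<le> C * r ^ n)"
    and "0 < \<epsilon> \<Longrightarrow> \<exists>r1>0. \<exists>T. finite T \<and> T \<subseteq> K \<and>
           (\<forall>r y. 0 < r \<and> r < r1 \<and> y \<in> K - (\<Union>t\<in>T. cball t r) \<longrightarrow> (1 - \<epsilon>) * v * r ^ n \<le> m y r)"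
    by blast+
qed

text \<open>
  A maximal \<open>2 * r\<close>-separated subset of the set \<open>P\<close> of points of low density has at least a constant
  times \<open>r^-s\<close> elements, because balls of radius \<open>2 * r\<close> around its points cover \<open>P\<close>, which has
  positive outer measure.
\<close>
lemma exists_sparse_packing:
  fixes K :: "(real ^ 'd) set"
  defines "H \<equiv> hausdorff_measure TYPE('s::finite) :: (real ^ 'd) measure"
    and "n \<equiv> CARD('s)" and "v \<equiv> unit_ball_vol (real CARD('s))"
  assumes \<mu>: "prob_space (uniform_measure H K)" and K: "K \<in> sets borel"
    and c: "0 < c" "0 < C" "0 < r0"
    and b: "\<And>x r. x \<in> K \<Longrightarrow> 0 < r \<Longrightarrow> r < r0 \<Longrightarrow> c * r ^ n \<le> measure H (cball x r \<inter> K) \<and> measure H (cball x r \<inter> K) \<le> C * r ^ n"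
    and \<epsilon>: "0 < \<epsilon>"
  shows "\<exists>\<kappa>>0. \<exists>r1>0. \<forall>r. 0 < r \<and> r < r1 \<longrightarrow>
       (\<exists>F. finite F \<and> F \<subseteq> K \<and> separated (2 * r) F \<and> \<kappa> \<le> real (card F) * r ^ n \<and>
            (\<forall>y\<in>F. measure H (cball y r \<inter> K) \<le> (1 + \<epsilon>) * v * r ^ n))"
proof -
  note fin = uniform_law_imp_hausdorff_measure[OF \<mu>[unfolded H_def] K]
  have sH: "sets H = sets borel" by (simp add: H_def sets_hausdorff_measure)
  have eH: "emeasure H A = hausdorff TYPE('s) A" if "A \<in> sets borel" for A
    using fin(3)[OF that] by (simp add: H_def)
  define \<nu> where "\<nu> = density H (indicator K)"
  have em\<nu>: "emeasure \<nu> A = emeasure H (K \<inter> A)" if "A \<in> sets borel" for A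
    unfolding \<nu>_def using K that sH by (intro emeasure_restricted) auto
  have s\<nu>: "sets \<nu> = sets borel" by (simp add: \<nu>_def sH)
  have sp\<nu>: "space \<nu> = UNIV" using sets_eq_imp_space_eq[OF s\<nu>] by simp
  have "hausdorff TYPE('s) K \<noteq> top" using fin(2) by auto
  then interpret \<nu>: finite_measure \<nu>
    by (intro finite_measureI) (simp add: sp\<nu> em\<nu> eH[OF K])
  have m\<nu>: "measure \<nu> A = measure H (A \<inter> K)" if "A \<in> sets borel" for A
    using em\<nu>[OF that] by (simp add: measure_def Int_commute)
  obtain \<delta> where \<delta>: "0 < \<delta>" and P0: "0 < hausdorff TYPE('s) {x \<in> K. \<forall>r. 0 < r \<and> r < \<delta> \<longrightarrow>
        measure H (cball x r \<inter> K) \<le> (1 + \<epsilon>) * v * r ^ n}" (is "0 < hausdorff _ ?P")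
    using exists_nonnull_low_density[OF K sH eH fin(1,2) \<epsilon>] unfolding v_def n_def by blast
  define P where "P = ?P"
  have PK: "P \<subseteq> K" by (auto simp: P_def)
  have P_low: "measure H (cball y r \<inter> K) \<le> (1 + \<epsilon>) * v * r ^ n" if "y \<in> P" "0 < r" "r < \<delta>" for y r
    using that by (simp add: P_def)
  have "hausdorff TYPE('s) P < top" using hausdorff_mono[OF PK, of "TYPE('s)"] fin(2) by (auto intro: order_le_less_trans)
  then have p0: "0 < enn2real (hausdorff TYPE('s) P)" using P0 by (simp add: P_def enn2real_positive_iff)
  have "\<exists>F. finite F \<and> F \<subseteq> K \<and> separated (2 * r) F \<and>
      enn2real (hausdorff TYPE('s) P) / (C * 2 ^ n) \<le> real (card F) * r ^ n \<and>
      (\<forall>y\<in>F. measure H (cball y r \<inter> K) \<le> (1 + \<epsilon>) * v * r ^ n)"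
    if r: "0 < r \<and> r < min \<delta> (r0 / 2)" for r
  proof -
    have pos: "0 < c * r ^ n" "0 < 2 * r" using r c by auto
    have low: "c * r ^ n \<le> measure \<nu> (cball z (2 * r / 2))" if "z \<in> P" for z
      using b[of z r] that PK r m\<nu>[of "cball z r"] by auto
    have "\<exists>F. finite F \<and> F \<subseteq> P \<and> separated (2 * r) F \<and> P \<subseteq> (\<Union>z\<in>F. cball z (2 * r))"
      by (rule exists_maximal_separated[OF \<nu>.finite_measure_axioms s\<nu> pos low])
    then obtain F where F: "finite F" "F \<subseteq> P" "separated (2 * r) F" "P \<subseteq> (\<Union>z\<in>F. cball z (2 * r))"
      by (elim exE conjE)
    let ?U = "\<Union>z\<in>F. cball z (2 * r)"
    have U: "?U \<in> sets borel" by (intro borel_closed closed_UN F(1)) auto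
    have "hausdorff TYPE('s) P \<le> hausdorff TYPE('s) (?U \<inter> K)"
      using F(4) PK by (intro hausdorff_mono) auto
    also have "\<dots> = emeasure \<nu> ?U" using U K by (simp add: eH em\<nu> Int_commute)
    also have "\<dots> = ennreal (measure \<nu> ?U)" by (rule \<nu>.emeasure_eq_measure)
    finally have "enn2real (hausdorff TYPE('s) P) \<le> measure \<nu> ?U" by (intro enn2real_leI) auto
    also have "\<dots> \<le> (\<Sum>z\<in>F. measure \<nu> (cball z (2 * r)))"
      by (rule \<nu>.finite_measure_subadditive_finite[OF F(1)]) (simp add: s\<nu> image_subset_iff)
    also have "\<dots> \<le> (\<Sum>z\<in>F. C * (2 * r) ^ n)"
    proof (rule sum_mono)
      fix z assume "z \<in> F"
      then have "z \<in> K" using F(2) PK by blast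
      then show "measure \<nu> (cball z (2 * r)) \<le> C * (2 * r) ^ n"
        using b[of z "2 * r"] r m\<nu>[of "cball z (2 * r)"] by simp
    qed
    also have "\<dots> = (C * 2 ^ n) * (real (card F) * r ^ n)" by (simp add: power_mult_distrib)
    finally have "enn2real (hausdorff TYPE('s) P) / (C * 2 ^ n) \<le> real (card F) * r ^ n"
      using c by (simp add: field_simps)
    then show ?thesis
      using F(1,3) order_trans[OF F(2) PK] P_low[of _ r] r F(2) by (intro exI[of _ F] conjI ballI) auto
  qed
  then have main: "\<forall>r. 0 < r \<and> r < min \<delta> (r0 / 2) \<longrightarrow> (\<exists>F. finite F \<and> F \<subseteq> K \<and> separated (2 * r) F \<and>
      enn2real (hausdorff TYPE('s) P) / (C * 2 ^ n) \<le> real (card F) * r ^ n \<and>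
      (\<forall>y\<in>F. measure H (cball y r \<inter> K) \<le> (1 + \<epsilon>) * v * r ^ n))"
    by (intro allI impI)
  have "0 < enn2real (hausdorff TYPE('s) P) / (C * 2 ^ n)" "0 < min \<delta> (r0 / 2)"
    using p0 c \<delta> by auto
  with main show ?thesis by (intro exI conjI)
qed

section \<open>The moments of the covering radius\<close>

theorem theorem3p2:
  fixes K :: "(real ^ 'd) set"
    and M :: "nat \<Rightarrow> 'w measure"
    and X :: "nat \<Rightarrow> nat \<Rightarrow> 'w \<Rightarrow> real ^ 'd"
    and p :: real
  assumes "CARD('s::finite) \<le> CARD('d)"
    and "asymptotically_flat_regular TYPE('s) K \<or> quasi_nice_regular TYPE('s) K"
    and "\<And>N. prob_space (M N)"
    and "\<And>N. prob_space.indep_vars (M N) (\<lambda>_. borel) (X N) {1..N}"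
    and "\<And>N j. j \<in> {1..N} \<Longrightarrow>
           distr (M N) borel (X N j) = uniform_measure (hausdorff_measure TYPE('s)) K"
    and "1 \<le> p"
  shows "(\<lambda>N. prob_space.expectation (M N)
                 (\<lambda>\<omega>. covering_radius ((\<lambda>j. X N j \<omega>) ` {1..N}) K powr p)
               * (real N / ln (real N)) powr (p / real CARD('s)))
         \<longlonglongrightarrow> (enn2real (hausdorff TYPE('s) K) / unit_ball_vol (real CARD('s)))
               powr (p / real CARD('s))"
proof -
  let ?n = "CARD('s)"
  let ?v = "unit_ball_vol (real ?n)"
  let ?H = "hausdorff_measure TYPE('s) :: (real ^ 'd) measure"
  define \<mu> where "\<mu> = uniform_measure ?H K"
  have K: "compact K"
    using assms(2) by (auto simp: asymptotically_flat_regular_def quasi_nice_regular_def)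
  then have Kb: "K \<in> sets borel" by (simp add: borel_compact)
  have \<mu>: "prob_space \<mu>"
  proof -
    interpret M1: prob_space "M 1" by (rule assms(3))
    have "X 1 1 \<in> borel_measurable (M 1)"
      using assms(4)[of 1] unfolding M1.indep_vars_def2 by auto
    from M1.prob_space_distr[OF this] show ?thesis using assms(5)[of 1 1] by (simp add: \<mu>_def)
  qed
  note H = uniform_law_imp_hausdorff_measure[OF \<mu>[unfolded \<mu>_def] Kb]
  define h where "h = enn2real (hausdorff TYPE('s) K)"
  have h: "0 < h" using H(1,2) by (simp add: h_def enn2real_positive_iff)
  have v: "0 < ?v" by (rule unit_ball_vol_pos) simp
  have mH: "measure ?H A = enn2real (hausdorff TYPE('s) A)" if "A \<in> sets borel" for A
    using H(3)[OF that] by (simp add: measure_def)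
  have eK: "emeasure ?H K = ennreal h" using H(2) H(3)[OF Kb] by (simp add: h_def)
  have m\<mu>: "measure \<mu> A = measure ?H (A \<inter> K) / h" if "A \<in> sets borel" for A
  proof -
    have "measure \<mu> A = measure ?H (K \<inter> A) / measure ?H K"
      unfolding \<mu>_def by (rule measure_uniform_measure) (use eK h that Kb in \<open>auto simp: sets_hausdorff_measure\<close>)
    then show ?thesis using mH[OF Kb] by (simp add: h_def Int_commute)
  qed
  have ball: "measure ?H (cball x r \<inter> K) = enn2real (hausdorff TYPE('s) (cball x r \<inter> K))" for x r
    using Kb by (intro mH) auto
  have \<mu>ball: "measure \<mu> (cball x r) = enn2real (hausdorff TYPE('s) (cball x r \<inter> K)) / h" for x r
    using m\<mu>[of "cball x r"] ball[of x r] by simp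
  obtain c C r0 where c: "0 < c" "0 < C" "0 < r0"
    and cC: "\<forall>x\<in>K. \<forall>r. 0 < r \<and> r < r0 \<longrightarrow> c * r ^ ?n \<le> enn2real (hausdorff TYPE('s) (cball x r \<inter> K))
              \<and> enn2real (hausdorff TYPE('s) (cball x r \<inter> K)) \<le> C * r ^ ?n"
    using regular_ball_bounds(1)[OF assms(2) H(2)] by blast
  interpret random_cover_sequence M X \<mu> K ?n "c / h" "C / h" r0 "?v / h"
  proof (rule random_cover_sequence.intro)
    show "random_cover (M N) (X N) N \<mu> K" if "1 \<le> N" for N
    proof (intro random_cover.intro random_cover_axioms.intro)
      show "measure \<mu> K = 1" using m\<mu>[OF Kb] mH[OF Kb] h by (simp add: h_def)
      show "K \<noteq> {}" using eK h by auto
    qed (use assms that K in \<open>auto simp: \<mu>_def\<close>)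
    show "0 < ?n" "0 < c / h" "0 < r0" "0 < ?v / h" using c h v by auto
    show "c / h * r ^ ?n \<le> measure \<mu> (cball x r)" "measure \<mu> (cball x r) \<le> C / h * r ^ ?n"
      if "x \<in> K" "0 < r" "r < r0" for x r
      using cC that h unfolding \<mu>ball by (simp_all add: divide_right_mono)
    fix \<epsilon> :: real assume \<epsilon>: "0 < \<epsilon>"
    have cancel: "a / h * b \<le> m / h \<longleftrightarrow> a * b \<le> m" "m / h \<le> a / h * b \<longleftrightarrow> m \<le> a * b" for a b m
      using h by (simp_all add: field_simps)
    show "\<exists>r1>0. \<exists>T. finite T \<and> T \<subseteq> K \<and>
       (\<forall>r y. 0 < r \<and> r < r1 \<and> y \<in> K - (\<Union>t\<in>T. cball t r) \<longrightarrow>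
          (1 - \<epsilon>) * (?v / h) * r ^ ?n \<le> measure \<mu> (cball y r))"
      using regular_ball_bounds(2)[OF assms(2) H(2) \<epsilon>] by (simp only: \<mu>ball cancel times_divide_eq_right)
    show "\<exists>\<kappa>>0. \<exists>r1>0. \<forall>r. 0 < r \<and> r < r1 \<longrightarrow>
       (\<exists>F. finite F \<and> F \<subseteq> K \<and> separated (2 * r) F \<and> \<kappa> \<le> real (card F) * r ^ ?n \<and>
            (\<forall>y\<in>F. measure \<mu> (cball y r) \<le> (1 + \<epsilon>) * (?v / h) * r ^ ?n))"
      using exists_sparse_packing[where 's = 's, OF \<mu>[unfolded \<mu>_def] Kb c _ \<epsilon>] cC
      by (simp only: \<mu>ball ball cancel times_divide_eq_right)
  qed
  show ?thesis
    using expectation_asymptotics[of p] assms(6) unfolding \<rho>_def h_def by simp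
qed

end
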